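(* Let $k$ be an infinite field with $\operatorname{char} k \neq 2$, and for a positive integer $n$ let $\mathrm{B}_n(k)$ be the group of invertible upper triangular $n\times n$ matrices over $k$. (1) If $2\leq n\leq 5$, then the number of $z$-classes in $\mathrm{B}_n(k)$ is finite. (2) If $n\geq 6$, then the number of $z$-classes in $\mathrm{B}_n(k)$ is infinite.
   Context: For a group $G$ and $x\in G$, let $\mathcal{Z}_G(x)=\{y\in G \mid xy=yx\}$ be the centralizer of $x$ in $G$. Two elements $x,y\in G$ are called $z$-equivalent (or $z$-conjugate), written $x\sim_z y$, if their centralizers are conjugate in $G$, i.e. $\mathcal{Z}_G(y)=g\,\mathcal{Z}_G(x)\,g^{-1}$ for some $g\in G$. This is an equivalence relation on $G$, and its equivalence classes are called the $z$-classes of $G$. $\mathrm{B}_n(k)$ is the subgroup of upper triangular matrices in $\mathrm{GL}_n(k)$. *)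

theory Defs
  imports "HOL-Algebra.Coset" "Jordan_Normal_Form.Matrix" "Jordan_Normal_Form.Determinant"
begin

definition centralizer :: "('a, 'b) monoid_scheme \<Rightarrow> 'a \<Rightarrow> 'a set" where
  "centralizer G x = {y \<in> carrier G. x \<otimes>\<^bsub>G\<^esub> y = y \<otimes>\<^bsub>G\<^esub> x}"

text \<open>The conjugator \<open>g\<close> ranges over \<open>G\<close> itself, so for a subgroup
  (regarded as a group) both centralizers and conjugation are taken inside the subgroup.\<close>

definition z_equivalence :: "('a, 'b) monoid_scheme \<Rightarrow> ('a \<times> 'a) set" where
  "z_equivalence G = {(x, y). x \<in> carrier G \<and> y \<in> carrier G \<and>
     (\<exists>g \<in> carrier G. centralizer G y = g <#\<^bsub>G\<^esub> centralizer G x #>\<^bsub>G\<^esub> inv\<^bsub>G\<^esub> g)}"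

definition z_classes :: "('a, 'b) monoid_scheme \<Rightarrow> 'a set set" where
  "z_classes G = carrier G // z_equivalence G"

text \<open>The units of the matrix ring over \<open>'k\<close>; the argument \<open>ty\<close> only
  fixes the field.\<close>

definition GL :: "'k::field itself \<Rightarrow> nat \<Rightarrow> 'k mat monoid" where
  "GL ty n = units_of (ring_mat ty n ())"

definition upper_GL :: "'k::field itself \<Rightarrow> nat \<Rightarrow> 'k mat monoid" where
  "upper_GL ty n = (GL ty n) \<lparr>carrier := {A \<in> carrier (GL ty n). upper_triangular A}\<rparr>"

lemma upper_triangular_mult:
  fixes A B :: "'k::semiring_0 mat"
  assumes "A \<in> carrier_mat n n" "B \<in> carrier_mat n n" "upper_triangular A" "upper_triangular B"
  shows "upper_triangular (A * B)"
proof (rule upper_triangularI)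
  fix i j assume "j < i" "i < dim_row (A * B)"
  then have ij: "j < i" "i < n" using assms(1) by auto
  have "(A * B) $$ (i, j) = (\<Sum>k = 0..<n. A $$ (i, k) * B $$ (k, j))"
    using ij assms(1,2) by (auto simp: scalar_prod_def)
  also have "\<dots> = 0"
  proof (rule sum.neutral, safe)
    fix k assume "k \<in> {0..<n}"
    then show "A $$ (i, k) * B $$ (k, j) = 0"
      using ij assms upper_triangularD[of A k i] upper_triangularD[of B j k]
      by (cases "k < i") auto
  qed
  finally show "(A * B) $$ (i, j) = 0" .
qed

lemma upper_triangular_inverse:
  fixes A B :: "'k::field mat"
  assumes A: "A \<in> carrier_mat n n" and B: "B \<in> carrier_mat n n"
    and upA: "upper_triangular A" and AB: "A * B = 1\<^sub>m n"
  shows "upper_triangular B"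
proof -
  have "det A * det B = 1" using det_mult[OF A B] AB by simp
  then have "det A \<noteq> 0" by auto
  then have diag: "A $$ (i, i) \<noteq> 0" if "i < n" for i
    using that A det_upper_triangular[OF upA A] by (auto simp: diag_mat_def)
  have row: "\<forall>j < n - Suc m. B $$ (n - Suc m, j) = 0" if "m < n" for m
    using that
  proof (induction m rule: less_induct)
    case (less m)
    define i where "i = n - Suc m"
    have i: "i < n" using less.prems i_def by simp
    show ?case
    proof (safe, fold i_def)
      fix j assume j: "j < i"
      have z: "A $$ (i, k) * B $$ (k, j) = 0" if k: "k \<in> {0..<n} - {i}" for k
      proof (cases "k < i")
        case True
        then show ?thesis using upper_triangularD[OF upA True] A i by auto
      next
        case False
        then have "i < k" "k < n" using k by auto
        then have "n - Suc k < m" "n - Suc k < n" "n - Suc (n - Suc k) = k"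
          using i_def by auto
        then have "B $$ (k, j) = 0" using less.IH[of "n - Suc k"] j \<open>i < k\<close> by auto
        then show ?thesis by simp
      qed
      have "0 = (A * B) $$ (i, j)" using AB i j by simp
      also have "\<dots> = (\<Sum>k = 0..<n. A $$ (i, k) * B $$ (k, j))"
        using i j A B by (auto simp: scalar_prod_def)
      also have "\<dots> = A $$ (i, i) * B $$ (i, j) + (\<Sum>k \<in> {0..<n} - {i}. A $$ (i, k) * B $$ (k, j))"
        using i by (intro sum.remove) auto
      also have "\<dots> = A $$ (i, i) * B $$ (i, j)"
        by (simp only: sum.neutral[OF ballI, OF z] add_0_right)
      finally show "B $$ (i, j) = 0" using diag[OF i] by simp
    qed
  qed
  have "B $$ (i, j) = 0" if "j < i" "i < n" for i j
  proof -
    have "n - Suc (n - Suc i) = i" "n - Suc i < n" using that by auto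
    then show ?thesis using row[of "n - Suc i"] that by simp
  qed
  then show ?thesis using B by auto
qed

lemma group_GL: "group (GL TYPE('k::field) n)"
  unfolding GL_def by (intro monoid.units_group ring.is_monoid ring_mat)

lemma subgroup_upper_GL: "subgroup (carrier (upper_GL TYPE('k::field) n)) (GL TYPE('k) n)"
proof -
  interpret group "GL TYPE('k) n" by (rule group_GL)
  have GLc: "A \<in> carrier_mat n n" if "A \<in> carrier (GL TYPE('k) n)" for A
    using that by (auto simp: GL_def units_of_def Units_def ring_mat_simps)
  have GLm: "A \<otimes>\<^bsub>GL TYPE('k) n\<^esub> B = A * B" for A B
    by (simp add: GL_def units_of_def ring_mat_simps)
  have GL1: "\<one>\<^bsub>GL TYPE('k) n\<^esub> = 1\<^sub>m n"
    by (simp add: GL_def units_of_def ring_mat_simps)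
  show ?thesis
  proof (rule subgroupI)
    show "carrier (upper_GL TYPE('k) n) \<subseteq> carrier (GL TYPE('k) n)"
      by (auto simp: upper_GL_def)
    have "1\<^sub>m n \<in> carrier (upper_GL TYPE('k) n)"
      using one_closed by (auto simp: upper_GL_def GL1)
    then show "carrier (upper_GL TYPE('k) n) \<noteq> {}" by auto
  next
    fix A assume "A \<in> carrier (upper_GL TYPE('k) n)"
    then have A: "A \<in> carrier (GL TYPE('k) n)" "upper_triangular A"
      by (auto simp: upper_GL_def)
    then have "A * inv\<^bsub>GL TYPE('k) n\<^esub> A = 1\<^sub>m n"
      using r_inv[of A] by (simp add: GLm GL1)
    then show "inv\<^bsub>GL TYPE('k) n\<^esub> A \<in> carrier (upper_GL TYPE('k) n)"
      using upper_triangular_inverse[OF GLc GLc A(2)] A by (auto simp: upper_GL_def)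
  next
    fix A B assume "A \<in> carrier (upper_GL TYPE('k) n)" "B \<in> carrier (upper_GL TYPE('k) n)"
    then show "A \<otimes>\<^bsub>GL TYPE('k) n\<^esub> B \<in> carrier (upper_GL TYPE('k) n)"
      using upper_triangular_mult[OF GLc GLc] m_closed[of A B]
      by (auto simp: upper_GL_def GLm)
  qed
qed

lemma group_upper_GL: "group (upper_GL TYPE('k::field) n)"
  using subgroup.subgroup_is_group[OF subgroup_upper_GL group_GL]
  by (simp add: upper_GL_def)

lemma (in group) equiv_z_equivalence: "equiv (carrier G) (z_equivalence G)"
proof -
  have sub: "centralizer G x \<subseteq> carrier G" for x by (auto simp: centralizer_def)
  have conj: "(h \<otimes> g) <# S #> inv (h \<otimes> g) = h <# (g <# S #> inv g) #> inv h"
    if "g \<in> carrier G" "h \<in> carrier G" "S \<subseteq> carrier G" for g h S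
    using that
    by (simp add: inv_mult_group lcos_m_assoc coset_assoc coset_mult_assoc[symmetric]
        l_coset_subset_G r_coset_subset_G)
  have conj1: "\<one> <# S #> inv \<one> = S" if "S \<subseteq> carrier G" for S
    using that by (simp add: lcos_mult_one)
  show ?thesis
  proof (rule equivI)
    show "z_equivalence G \<subseteq> carrier G \<times> carrier G"
      by (auto simp: z_equivalence_def)
    show "refl_on (carrier G) (z_equivalence G)"
      unfolding refl_on_def z_equivalence_def using conj1[OF sub] by (auto intro!: bexI[of _ \<one>])
    show "sym (z_equivalence G)"
    proof (rule symI)
      fix x y assume "(x, y) \<in> z_equivalence G"
      then obtain g where g: "x \<in> carrier G" "y \<in> carrier G" "g \<in> carrier G"
        "centralizer G y = g <# centralizer G x #> inv g"
        by (auto simp: z_equivalence_def)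
      have "centralizer G x = inv g <# centralizer G y #> inv (inv g)"
        using conj[of g "inv g" "centralizer G x"] g conj1 sub by simp
      then show "(y, x) \<in> z_equivalence G"
        using g by (auto simp: z_equivalence_def intro!: bexI[of _ "inv g"])
    qed
    show "trans (z_equivalence G)"
    proof (rule transI)
      fix x y w assume "(x, y) \<in> z_equivalence G" "(y, w) \<in> z_equivalence G"
      then obtain g h where g: "x \<in> carrier G" "w \<in> carrier G" "g \<in> carrier G" "h \<in> carrier G"
        "centralizer G y = g <# centralizer G x #> inv g"
        "centralizer G w = h <# centralizer G y #> inv h"
        by (auto simp: z_equivalence_def)
      then have "centralizer G w = (h \<otimes> g) <# centralizer G x #> inv (h \<otimes> g)"
        using conj sub by simp
      then show "(x, w) \<in> z_equivalence G"
        using g by (auto simp: z_equivalence_def intro!: bexI[of _ "h \<otimes> g"])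
    qed
  qed
qed

end

theory Submission
  imports Defs
begin

text \<open>
  \<^bold>\<open>Small \<open>n\<close>.\<close>
  Conjugating by upper triangular matrices only, every upper triangular matrix can be brought to
  the form \<open>D + N\<close> with \<open>D\<close> diagonal, \<open>N\<close> strictly upper triangular and \<open>N i j \<noteq> 0\<close> only between
  equal eigenvalues (\<open>tri_sim_separated\<close>). On each eigenvalue the matrix \<open>N\<close> is nilpotent of size at
  most 5, and there the Borel group has finitely many orbits, represented by matrices with entries
  0 and 1 (\<open>nilpotent_tri_sim_zero_one\<close>). The centralizer of such a normal form depends only on the
  0-1 pattern of \<open>N\<close> and on which diagonal entries coincide (\<open>commutant_same_pattern\<close>), so there are
  finitely many centralizers up to conjugation.

  The nilpotent orbits are found column by column. If the leading block \<open>C\<close> is already normal, then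
  the last column is a vector modulo the image of \<open>C\<close>, acted on by the upper triangular commutant
  of \<open>C\<close>. When \<open>C\<close> has at most one 1 in each row and column, its Jordan chains are the orbits of a
  partial injection \<open>\<sigma>\<close> on basis vectors, the cokernel has one basis vector per chain, and an
  entry at the top of one chain clears an entry at the top of another whenever the first chain
  dominates the second. What is left is a 0-1 vector supported on an antichain of chains
  (\<open>column_equiv_rook\<close>). In size at most 3 there is exactly one antichain with two members, which
  yields the only further normal form of size 4 (\<open>branched\<close>); its columns are treated by hand to
  reach size 5.

  \<^bold>\<open>Large \<open>n\<close>.\<close>
  In size 6 the nilpotent orbits come in one-parameter families. For the family \<open>pencil t\<close> below the
  parameter is even visible in the centralizer: if the centralizers for \<open>s\<close> and \<open>t\<close> are conjugate by
  \<open>g\<close>, then \<open>u = g\<inverse> (1 + pencil s) g\<close> commutes with everything that commutes with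
  \<open>1 + pencil t\<close>. A few explicit elements of the centralizer force \<open>u - 1\<close> to be \<open>c\<close> times
  \<open>pencil t\<close> in all the entries that matter, and comparing entries of \<open>(1 + pencil s) g = g u\<close> gives
  \<open>s = t\<close> (\<open>pencil_parameter_determined\<close>). Placing the family in the upper left corner handles all
  \<open>n \<ge> 6\<close>, because taking the upper left block is multiplicative on upper triangular matrices.
\<close>

section \<open>Upper triangular similarity over a finite linear order\<close>

text \<open>Matrices are functions on a finite linearly ordered index set rather than on an initial segment
  of the natural numbers, so that the block of a single eigenvalue, whose indices need not be
  consecutive, is again a matrix of the same kind.\<close>

definition tri_unit :: "'i::linorder set \<Rightarrow> ('i \<Rightarrow> 'i \<Rightarrow> 'k::field) \<Rightarrow> bool" where
  "tri_unit S g \<longleftrightarrow> (\<forall>i\<in>S. g i i \<noteq> 0) \<and> (\<forall>i\<in>S. \<forall>j\<in>S. j < i \<longrightarrow> g i j = 0)"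

definition intertwines :: "'i set \<Rightarrow> ('i \<Rightarrow> 'i \<Rightarrow> 'k::field) \<Rightarrow> ('i \<Rightarrow> 'i \<Rightarrow> 'k) \<Rightarrow> ('i \<Rightarrow> 'i \<Rightarrow> 'k) \<Rightarrow> bool" where
  "intertwines S g A C \<longleftrightarrow>
     (\<forall>i\<in>S. \<forall>j\<in>S. (\<Sum>k\<in>S. g i k * A k j) = (\<Sum>k\<in>S. C i k * g k j))"

definition tri_sim :: "'i::linorder set \<Rightarrow> ('i \<Rightarrow> 'i \<Rightarrow> 'k::field) \<Rightarrow> ('i \<Rightarrow> 'i \<Rightarrow> 'k) \<Rightarrow> bool" where
  "tri_sim S A C \<longleftrightarrow> (\<exists>g. tri_unit S g \<and> intertwines S g A C)"

abbreviation id_fun :: "'i \<Rightarrow> 'i \<Rightarrow> 'k::field" where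
  "id_fun \<equiv> \<lambda>i j. if i = j then 1 else 0"

lemma sum_id_fun_left: 
  "finite S \<Longrightarrow> i \<in> S \<Longrightarrow> (\<Sum>k\<in>S. id_fun i k * f k) = (f i :: 'k::field)"
  by (simp add: if_distrib[of "\<lambda>x. x * _"] cong: if_cong)

lemma sum_id_fun_right: 
  "finite S \<Longrightarrow> i \<in> S \<Longrightarrow> (\<Sum>k\<in>S. f k * id_fun k i) = (f i :: 'k::field)"
  by (simp add: if_distrib[of "\<lambda>x. _ * x"] cong: if_cong)

lemma tri_unit_id: "tri_unit S id_fun"
  by (auto simp: tri_unit_def)

lemma tri_unit_mult:
  assumes S: "finite S" and h: "tri_unit S h" and g: "tri_unit S g"
  shows "tri_unit S (\<lambda>i j. \<Sum>k\<in>S. h i k * g k j)"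
  unfolding tri_unit_def
proof (intro conjI ballI impI)
  fix i assume i: "i \<in> S"
  have "(\<Sum>k\<in>S. h i k * g k i) = (\<Sum>k\<in>{i}. h i k * g k i)"
    using i S h g by (intro sum.mono_neutral_right) (auto simp: tri_unit_def neq_iff)
  then show "(\<Sum>k\<in>S. h i k * g k i) \<noteq> 0"
    using i h g by (simp add: tri_unit_def)
next
  fix i j assume ij: "i \<in> S" "j \<in> S" "j < i"
  have "h i k * g k j = 0" if "k \<in> S" for k
    using that ij h g by (cases "k < i") (auto simp: tri_unit_def)
  then show "(\<Sum>k\<in>S. h i k * g k j) = 0" by (rule sum.neutral[OF ballI])
qed

lemma sum_mult_assoc:
  fixes f :: "'i \<Rightarrow> 'k::field"
  shows "(\<Sum>k\<in>S. (\<Sum>l\<in>S. f l * g l k) * h k) = (\<Sum>l\<in>S. f l * (\<Sum>k\<in>S. g l k * h k))"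
  by (simp add: sum_distrib_left sum_distrib_right mult.assoc) (rule sum.swap)

lemma intertwines_mult:
  assumes h: "intertwines S h B C" and g: "intertwines S g A B"
  shows "intertwines S (\<lambda>i j. \<Sum>k\<in>S. h i k * g k j) A C"
  unfolding intertwines_def
proof (intro ballI)
  fix i j assume ij: "i \<in> S" "j \<in> S"
  have "(\<Sum>k\<in>S. (\<Sum>l\<in>S. h i l * g l k) * A k j) = (\<Sum>l\<in>S. h i l * (\<Sum>k\<in>S. g l k * A k j))"
    by (rule sum_mult_assoc)
  also have "\<dots> = (\<Sum>l\<in>S. h i l * (\<Sum>k\<in>S. B l k * g k j))"
    using g ij by (intro sum.cong) (auto simp: intertwines_def)
  also have "\<dots> = (\<Sum>k\<in>S. (\<Sum>l\<in>S. h i l * B l k) * g k j)"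
    by (rule sum_mult_assoc[symmetric])
  also have "\<dots> = (\<Sum>k\<in>S. (\<Sum>l\<in>S. C i l * h l k) * g k j)"
    using h ij by (intro sum.cong) (auto simp: intertwines_def)
  also have "\<dots> = (\<Sum>l\<in>S. C i l * (\<Sum>k\<in>S. h l k * g k j))"
    by (rule sum_mult_assoc)
  finally show "(\<Sum>k\<in>S. (\<Sum>l\<in>S. h i l * g l k) * A k j) = (\<Sum>k\<in>S. C i k * (\<Sum>l\<in>S. h k l * g l j))" .
qed

lemma intertwines_cong:
  assumes "\<And>i j. i \<in> S \<Longrightarrow> j \<in> S \<Longrightarrow> A i j = A' i j" "\<And>i j. i \<in> S \<Longrightarrow> j \<in> S \<Longrightarrow> C i j = C' i j"
  shows "intertwines S g A C \<longleftrightarrow> intertwines S g A' C'"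
  using assms by (simp add: intertwines_def)

lemma intertwines_id: "finite S \<Longrightarrow> intertwines S id_fun A A"
  unfolding intertwines_def by (intro ballI) (simp only: sum_id_fun_left sum_id_fun_right)

lemma tri_sim_trans:
  assumes "finite S" "tri_sim S A B" "tri_sim S B C"
  shows "tri_sim S A C"
proof -
  obtain g h where "tri_unit S g" "intertwines S g A B" "tri_unit S h" "intertwines S h B C"
    using assms unfolding tri_sim_def by auto
  then show ?thesis
    unfolding tri_sim_def
    by (intro exI[of _ "\<lambda>i j. \<Sum>k\<in>S. h i k * g k j"] conjI tri_unit_mult intertwines_mult assms(1))
qed

lemma tri_sim_cong:
  assumes "\<And>i j. i \<in> S \<Longrightarrow> j \<in> S \<Longrightarrow> A i j = A' i j" "\<And>i j. i \<in> S \<Longrightarrow> j \<in> S \<Longrightarrow> C i j = C' i j"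
  shows "tri_sim S A C \<longleftrightarrow> tri_sim S A' C'"
  unfolding tri_sim_def by (intro ex_cong1 conj_cong refl intertwines_cong assms)

lemma tri_sim_refl: "finite S \<Longrightarrow> tri_sim S A A"
  unfolding tri_sim_def by (rule exI[of _ id_fun]) (simp only: tri_unit_id intertwines_id simp_thms)

text \<open>The block matrix \<open>[A v; 0 d]\<close>, where \<open>m\<close> is the index of the new row and column.\<close>

definition border :: "'i \<Rightarrow> ('i \<Rightarrow> 'i \<Rightarrow> 'k::field) \<Rightarrow> ('i \<Rightarrow> 'k) \<Rightarrow> 'k \<Rightarrow> 'i \<Rightarrow> 'i \<Rightarrow> 'k" where
  "border m A v d i j =
     (if j = m then if i = m then d else v i else if i = m then 0 else A i j)"

text \<open>All normal forms are built by adding a last column, conjugating by block matrices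
  \<open>[g w; 0 c]\<close>: the block \<open>g\<close> acts on the old part, and \<open>w\<close> changes the new column by multiples of
  the columns of \<open>C - d\<close>.\<close>

lemma tri_sim_border:
  assumes S: "finite S" "\<forall>i\<in>S. i < m" and g: "tri_unit S g" "intertwines S g A C" and c: "c \<noteq> 0"
    and v: "\<And>i. i \<in> S \<Longrightarrow> (\<Sum>k\<in>S. g i k * v k) + w i * d = (\<Sum>k\<in>S. C i k * w k) + u i * c"
  shows "tri_sim (insert m S) (border m A v d) (border m C u d)"
  unfolding tri_sim_def
proof (intro exI conjI)
  have m: "m \<notin> S" and ne: "\<And>i. i \<in> S \<Longrightarrow> i \<noteq> m" using S by auto
  show "tri_unit (insert m S) (border m g w c)"
    using S g(1) c by (auto simp: tri_unit_def border_def)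
  have sum: "(\<Sum>k\<in>S. border m E e x i k * border m F f y k j)
     = (if i = m then 0 else if j = m then \<Sum>k\<in>S. E i k * f k else \<Sum>k\<in>S. E i k * F k j)" for i j E e x F f y
    using ne by (auto simp: border_def intro!: sum.cong sum.neutral)
  have border: "border m E e x i m = (if i = m then x else e i)"
    "j \<noteq> m \<Longrightarrow> border m E e x i j = (if i = m then 0 else E i j)" for E e x i j
    by (auto simp: border_def)
  show "intertwines (insert m S) (border m g w c) (border m A v d) (border m C u d)"
    unfolding intertwines_def
  proof (intro ballI)
    fix i j assume ij: "i \<in> insert m S" "j \<in> insert m S"
    show "(\<Sum>k\<in>insert m S. border m g w c i k * border m A v d k j)
        = (\<Sum>k\<in>insert m S. border m C u d i k * border m g w c k j)"
      unfolding sum.insert[OF S(1) m] sum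
      using ij m g(2) v[of i] ne[of i] ne[of j]
      by (cases "i = m"; cases "j = m") (simp_all add: border intertwines_def algebra_simps)
  qed
qed

section \<open>Separating the eigenvalues\<close>

lemma triangular_solve:
  fixes M :: "'i::linorder \<Rightarrow> 'i \<Rightarrow> 'k::field"
  assumes "finite S" "\<forall>i\<in>S. M i i \<noteq> 0" "\<forall>i\<in>S. \<forall>j\<in>S. j < i \<longrightarrow> M i j = 0"
  shows "\<exists>w. \<forall>i\<in>S. (\<Sum>k\<in>S. M i k * w k) = v i"
  using assms
proof (induction S rule: finite_linorder_min_induct)
  case empty
  then show ?case by simp
next
  case (insert m S)
  then obtain w where w: "\<forall>i\<in>S. (\<Sum>k\<in>S. M i k * w k) = v i" by auto
  define w' where "w' = w(m := (v m - (\<Sum>k\<in>S. M m k * w k)) / M m m)"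
  have m: "m \<notin> S" using insert by auto
  have *: "(\<Sum>k\<in>S. M i k * w' k) = (\<Sum>k\<in>S. M i k * w k)" for i
    using m by (intro sum.cong) (auto simp: w'_def)
  have "(\<Sum>k\<in>insert m S. M i k * w' k) = v i" if "i \<in> insert m S" for i
  proof (cases "i = m")
    case True
    have "w' m = (v m - (\<Sum>k\<in>S. M m k * w k)) / M m m" by (simp add: w'_def)
    then show ?thesis using True insert(1) m insert.prems by (simp add: *)
  next
    case False
    then have "i \<in> S" "M i m = 0" using that insert(2) insert.prems by auto
    then show ?thesis using insert(1) m w by (simp add: *)
  qed
  then show ?case by blast
qed

definition separated :: "'i::linorder set \<Rightarrow> ('i \<Rightarrow> 'i \<Rightarrow> 'k::field) \<Rightarrow> bool" where
  "separated S C \<longleftrightarrow> (\<forall>i\<in>S. \<forall>j\<in>S. C i j \<noteq> 0 \<longrightarrow> i \<le> j \<and> C i i = C j j)"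

text \<open>When the last column with eigenvalue \<open>d\<close> is added, \<open>C - d\<close> is invertible on the indices \<open>R\<close>
  whose eigenvalue differs from \<open>d\<close>, so the entries of the column there can be solved away. The
  solution vector lives on \<open>R\<close>, and \<open>C\<close> maps such vectors to such vectors, so the remaining entries
  stay as they are.\<close>

lemma tri_sim_separated:
  fixes A :: "'i::linorder \<Rightarrow> 'i \<Rightarrow> 'k::field"
  assumes "finite S" "\<forall>i\<in>S. \<forall>j\<in>S. j < i \<longrightarrow> A i j = 0"
  shows "\<exists>C. tri_sim S A C \<and> separated S C"
  using assms
proof (induction S rule: finite_linorder_max_induct)
  case empty
  then show ?case using tri_sim_refl[of "{}" A] by (auto simp: separated_def)
next
  case (insert m S)
  then obtain C g where g: "tri_unit S g" "intertwines S g A C" and C: "separated S C"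
    using insert.IH insert.prems unfolding tri_sim_def by (metis insertCI)
  define d where "d = A m m"
  define v where "v = (\<lambda>i. \<Sum>k\<in>S. g i k * A k m)"
  define R where "R = {i \<in> S. C i i \<noteq> d}"
  have "\<exists>w. \<forall>i\<in>R. (\<Sum>k\<in>R. (C i k - d * id_fun i k) * w k) = v i"
  proof (rule triangular_solve)
    show "\<forall>i\<in>R. \<forall>j\<in>R. j < i \<longrightarrow> C i j - d * id_fun i j = 0"
    proof (intro ballI impI)
      fix i j assume "i \<in> R" "j \<in> R" "j < i"
      then have "C i j = 0" "i \<noteq> j" using C unfolding R_def separated_def by (auto dest: leD)
      then show "C i j - d * id_fun i j = 0" by simp
    qed
  qed (use insert(1) in \<open>auto simp: R_def\<close>)
  then obtain w0 where w0: "\<And>i. i \<in> R \<Longrightarrow> (\<Sum>k\<in>R. (C i k - d * id_fun i k) * w0 k) = v i" by blast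
  define w where "w = (\<lambda>i. if i \<in> R then w0 i else 0)"
  define u where "u = (\<lambda>i. if i \<in> R then 0 else v i)"
  have Cw: "(\<Sum>k\<in>S. C i k * w k) = (\<Sum>k\<in>R. C i k * w0 k)" for i
    using insert(1) unfolding R_def w_def by (intro sum.mono_neutral_cong_right) auto
  have key: "v i + w i * d = (\<Sum>k\<in>S. C i k * w k) + u i * 1" if i: "i \<in> S" for i
  proof (cases "i \<in> R")
    case True
    have R: "finite R" using insert(1) by (simp add: R_def)
    have "(\<Sum>k\<in>R. (C i k - d * id_fun i k) * w0 k)
        = (\<Sum>k\<in>R. C i k * w0 k) - d * (\<Sum>k\<in>R. id_fun i k * w0 k)"
      unfolding left_diff_distrib sum_subtractf sum_distrib_left mult.assoc ..
    also have "\<dots> = (\<Sum>k\<in>R. C i k * w0 k) - d * w0 i"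
      unfolding sum_id_fun_left[OF R True] ..
    finally have "v i = (\<Sum>k\<in>R. C i k * w0 k) - d * w0 i" unfolding w0[OF True] .
    moreover have "w i = w0 i" "u i = 0" using True by (simp_all add: w_def u_def)
    ultimately show ?thesis unfolding Cw by (simp add: mult.commute)
  next
    case False
    have "C i k * w0 k = 0" if "k \<in> R" for k
    proof -
      have "C i i \<noteq> C k k" "k \<in> S" using that False i by (auto simp: R_def)
      then have "C i k = 0" using C i unfolding separated_def by blast
      then show ?thesis by simp
    qed
    then have "(\<Sum>k\<in>R. C i k * w0 k) = 0" by (rule sum.neutral[OF ballI])
    moreover have "w i = 0" "u i = v i" using False by (simp_all add: w_def u_def)
    ultimately show ?thesis unfolding Cw by simp
  qed
  have "tri_sim (insert m S) (border m A (\<lambda>i. A i m) d) (border m C u d)"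
    using tri_sim_border[OF insert(1,2) g one_neq_zero key[unfolded v_def]] .
  moreover have "border m A (\<lambda>i. A i m) d i j = A i j" if "i \<in> insert m S" "j \<in> insert m S" for i j
    using that insert(2) insert.prems by (auto simp: border_def d_def)
  ultimately have "tri_sim (insert m S) A (border m C u d)"
    using tri_sim_cong[of "insert m S" "border m A (\<lambda>i. A i m) d" A "border m C u d" "border m C u d"]
    by blast
  moreover have "separated (insert m S) (border m C u d)"
    unfolding separated_def
  proof (intro ballI impI)
    fix i j assume ij: "i \<in> insert m S" "j \<in> insert m S" and nz: "border m C u d i j \<noteq> 0"
    show "i \<le> j \<and> border m C u d i i = border m C u d j j"
    proof (cases "j = m")
      case True
      then show ?thesis
        using ij nz insert(2) by (cases "i = m") (auto simp: border_def u_def R_def split: if_splits)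
    next
      case False
      then have "i \<noteq> m" "C i j \<noteq> 0" using nz by (auto simp: border_def split: if_splits)
      then show ?thesis using False ij C by (auto simp: border_def separated_def)
    qed
  qed
  ultimately show ?case by blast
qed

section \<open>Adding a column to a rook placement\<close>

definition strict_upper :: "'i::linorder set \<Rightarrow> ('i \<Rightarrow> 'i \<Rightarrow> 'k::field) \<Rightarrow> bool" where
  "strict_upper S A \<longleftrightarrow> (\<forall>i\<in>S. \<forall>j\<in>S. A i j \<noteq> 0 \<longrightarrow> i < j)"

definition zero_one :: "'i set \<Rightarrow> ('i \<Rightarrow> 'i \<Rightarrow> 'k::field) \<Rightarrow> bool" where
  "zero_one S A \<longleftrightarrow> (\<forall>i\<in>S. \<forall>j\<in>S. A i j \<in> {0, 1})"

text \<open>The ones are non-attacking rooks: read as \<open>C e\<^sub>j = e\<^sub>i\<close> when \<open>C i j = 1\<close>, such a matrix is a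
  partial injection on the basis vectors which lowers indices.\<close>

definition rook :: "'i::linorder set \<Rightarrow> ('i \<Rightarrow> 'i \<Rightarrow> 'k::field) \<Rightarrow> bool" where
  "rook S C \<longleftrightarrow> strict_upper S C \<and> zero_one S C \<and>
     (\<forall>i\<in>S. \<forall>j\<in>S. \<forall>k\<in>S. C i j \<noteq> 0 \<and> C i k \<noteq> 0 \<longrightarrow> j = k) \<and>
     (\<forall>i\<in>S. \<forall>j\<in>S. \<forall>k\<in>S. C i k \<noteq> 0 \<and> C j k \<noteq> 0 \<longrightarrow> i = j)"

lemma rookD:
  assumes "rook S C" "i \<in> S" "j \<in> S"
  shows "C i j \<noteq> 0 \<Longrightarrow> i < j" "C i j \<noteq> 0 \<Longrightarrow> C i j = 1"
    "\<lbrakk>k \<in> S; C i j \<noteq> 0; C i k \<noteq> 0\<rbrakk> \<Longrightarrow> j = k"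
    "\<lbrakk>k \<in> S; C i k \<noteq> 0; C j k \<noteq> 0\<rbrakk> \<Longrightarrow> i = j"
  using assms unfolding rook_def strict_upper_def zero_one_def by blast+

text \<open>Two last columns are equivalent when the upper triangular commutant of \<open>C\<close> carries one to the other
  modulo the image of \<open>C\<close>. It makes the bordered nilpotent matrices similar without changing the upper
  left block.\<close>

definition column_equiv ::
  "'i::linorder set \<Rightarrow> ('i \<Rightarrow> 'i \<Rightarrow> 'k::field) \<Rightarrow> ('i \<Rightarrow> 'k) \<Rightarrow> ('i \<Rightarrow> 'k) \<Rightarrow> bool" where
  "column_equiv S C v u \<longleftrightarrow> (\<exists>g w. tri_unit S g \<and> intertwines S g C C \<and>
     (\<forall>i\<in>S. (\<Sum>k\<in>S. g i k * v k) = (\<Sum>k\<in>S. C i k * w k) + u i))"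

lemma column_equivI:
  assumes "tri_unit S g" "intertwines S g C C"
    "\<And>i. i \<in> S \<Longrightarrow> (\<Sum>k\<in>S. g i k * v k) = (\<Sum>k\<in>S. C i k * w k) + u i"
  shows "column_equiv S C v u"
  using assms unfolding column_equiv_def by auto

lemma column_equiv_refl:
  assumes "finite S"
  shows "column_equiv S C v v"
  using assms
  by (intro column_equivI[where g = id_fun and w = "\<lambda>_. 0"] tri_unit_id intertwines_id)
    (simp_all only: sum_id_fun_left mult_zero_right sum.neutral_const add_0_left)

lemma column_equiv_trans:
  assumes "finite S" "column_equiv S C v u" "column_equiv S C u t"
  shows "column_equiv S C v t"
proof -
  obtain g w where g: "tri_unit S g" "intertwines S g C C"
    "\<And>i. i \<in> S \<Longrightarrow> (\<Sum>k\<in>S. g i k * v k) = (\<Sum>k\<in>S. C i k * w k) + u i"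
    using assms(2) unfolding column_equiv_def by blast
  obtain h x where h: "tri_unit S h" "intertwines S h C C"
    "\<And>i. i \<in> S \<Longrightarrow> (\<Sum>k\<in>S. h i k * u k) = (\<Sum>k\<in>S. C i k * x k) + t i"
    using assms(3) unfolding column_equiv_def by blast
  show ?thesis
  proof (rule column_equivI)
    show "tri_unit S (\<lambda>i j. \<Sum>k\<in>S. h i k * g k j)"
      using tri_unit_mult[OF assms(1) h(1) g(1)] .
    show "intertwines S (\<lambda>i j. \<Sum>k\<in>S. h i k * g k j) C C"
      using intertwines_mult[OF h(2) g(2)] .
    fix i assume i: "i \<in> S"
    have "(\<Sum>k\<in>S. (\<Sum>l\<in>S. h i l * g l k) * v k) = (\<Sum>l\<in>S. h i l * (\<Sum>k\<in>S. g l k * v k))"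
      by (rule sum_mult_assoc)
    also have "\<dots> = (\<Sum>l\<in>S. h i l * ((\<Sum>k\<in>S. C l k * w k) + u l))"
      using g(3) by (intro sum.cong) auto
    also have "\<dots> = (\<Sum>l\<in>S. h i l * (\<Sum>k\<in>S. C l k * w k)) + (\<Sum>l\<in>S. h i l * u l)"
      by (simp add: distrib_left sum.distrib)
    also have "(\<Sum>l\<in>S. h i l * (\<Sum>k\<in>S. C l k * w k)) = (\<Sum>k\<in>S. (\<Sum>l\<in>S. h i l * C l k) * w k)"
      by (rule sum_mult_assoc[symmetric])
    also have "\<dots> = (\<Sum>k\<in>S. (\<Sum>l\<in>S. C i l * h l k) * w k)"
      using h(2) i by (intro sum.cong) (auto simp: intertwines_def)
    also have "\<dots> = (\<Sum>l\<in>S. C i l * (\<Sum>k\<in>S. h l k * w k))"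
      by (rule sum_mult_assoc)
    finally show "(\<Sum>k\<in>S. (\<Sum>l\<in>S. h i l * g l k) * v k)
        = (\<Sum>k\<in>S. C i k * ((\<Sum>l\<in>S. h k l * w l) + x k)) + t i"
      by (simp add: h(3)[OF i] distrib_left sum.distrib)
  qed
qed

lemma column_equiv_border:
  assumes S: "finite S" "\<forall>i\<in>S. i < m" and v: "column_equiv S C v u"
  shows "tri_sim (insert m S) (border m C v 0) (border m C u 0)"
proof -
  obtain g w where g: "tri_unit S g" "intertwines S g C C"
    "\<And>i. i \<in> S \<Longrightarrow> (\<Sum>k\<in>S. g i k * v k) = (\<Sum>k\<in>S. C i k * w k) + u i"
    using v unfolding column_equiv_def by blast
  show ?thesis
    by (rule tri_sim_border[OF S g(1,2) one_neq_zero, where w = w]) (simp add: g(3))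
qed

lemma rook_row_sum:
  assumes "finite S" "rook S C" "i \<in> S" "k \<in> S" "C i k \<noteq> 0"
  shows "(\<Sum>l\<in>S. C i l * f l) = f k"
proof -
  have "(\<Sum>l\<in>S. C i l * f l) = (\<Sum>l\<in>{k}. C i l * f l)"
  proof (rule sum.mono_neutral_right)
    show "\<forall>l\<in>S - {k}. C i l * f l = 0"
      using rookD(3)[OF assms(2,3,4) _ assms(5)] by fastforce
  qed (use assms in auto)
  moreover have "C i k = 1" using assms rookD(2) by blast
  ultimately show ?thesis by simp
qed

lemma rook_column_sum:
  assumes "finite S" "rook S C" "j \<in> S" "k \<in> S" "C k j \<noteq> 0"
  shows "(\<Sum>l\<in>S. f l * C l j) = f k"
proof -
  have "(\<Sum>l\<in>S. f l * C l j) = (\<Sum>l\<in>{k}. f l * C l j)"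
  proof (rule sum.mono_neutral_right)
    show "\<forall>l\<in>S - {k}. f l * C l j = 0"
      using rookD(4)[OF assms(2,4) _ assms(3) assms(5)] by fastforce
  qed (use assms in auto)
  moreover have "C k j = 1" using assms rookD(2) by blast
  ultimately show ?thesis by simp
qed

text \<open>For tops \<open>p\<close> and \<open>q\<close> of two chains of \<open>C\<close>, the pairs reached by moving down both chains in step.
  The matrix sending \<open>e\<^sub>x\<close> to \<open>e\<^sub>y\<close> for all these pairs is the candidate for an element of
  the commutant taking \<open>e\<^sub>p\<close> to \<open>e\<^sub>q\<close>.\<close>

inductive chain_pair :: "'i set \<Rightarrow> ('i \<Rightarrow> 'i \<Rightarrow> 'k::field) \<Rightarrow> 'i \<Rightarrow> 'i \<Rightarrow> 'i \<Rightarrow> 'i \<Rightarrow> bool"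
  for S C p q where
  base: "chain_pair S C p q p q"
| step: "\<lbrakk>chain_pair S C p q x y; x' \<in> S; y' \<in> S; C x' x \<noteq> 0; C y' y \<noteq> 0\<rbrakk>
    \<Longrightarrow> chain_pair S C p q x' y'"

text \<open>The first conjunct makes that candidate upper triangular. The second says that the chain of \<open>q\<close>
  does not outlast the chain of \<open>p\<close>, without which the candidate would not commute with \<open>C\<close>.\<close>

definition dominates :: "'i::linorder set \<Rightarrow> ('i \<Rightarrow> 'i \<Rightarrow> 'k::field) \<Rightarrow> 'i \<Rightarrow> 'i \<Rightarrow> bool" where
  "dominates S C p q \<longleftrightarrow> (\<forall>x y. chain_pair S C p q x y \<longrightarrow>
     y \<le> x \<and> ((\<exists>y'\<in>S. C y' y \<noteq> 0) \<longrightarrow> (\<exists>x'\<in>S. C x' x \<noteq> 0)))"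

text \<open>The tops of chains: exactly these basis vectors are outside the image of a rook placement \<open>C\<close>.\<close>

definition row_free :: "'i set \<Rightarrow> ('i \<Rightarrow> 'i \<Rightarrow> 'k::field) \<Rightarrow> 'i \<Rightarrow> bool" where
  "row_free S C i \<longleftrightarrow> (\<forall>j\<in>S. C i j = 0)"

lemma chain_pair_in: "chain_pair S C p q x y \<Longrightarrow> p \<in> S \<Longrightarrow> q \<in> S \<Longrightarrow> x \<in> S \<and> y \<in> S"
  by (induction rule: chain_pair.induct) auto

lemma chain_pair_diagonal:
  assumes "chain_pair S C p q x x" "rook S C" "p \<in> S" "q \<in> S"
  shows "p = q"
proof -
  have "p = q" if "chain_pair S C p q x y" "x = y" for x y
    using that
  proof (induction rule: chain_pair.induct)
    case (step x y x' y')
    then have "x = y" 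
      using chain_pair_in[OF step.hyps(1) assms(3,4)] rookD(3)[OF assms(2)] by blast
    then show ?case using step by blast
  qed
  then show ?thesis using assms(1) by blast
qed

lemma chain_pair_same:
  assumes "chain_pair S C p p x y" "rook S C" "p \<in> S"
  shows "x = y"
  using assms(1)
proof (induction rule: chain_pair.induct)
  case (step x y x' y')
  then show ?case
    using chain_pair_in[OF step.hyps(1) assms(3,3)] rookD(4)[OF assms(2)] by blast
qed simp

lemma dominates_refl: "rook S C \<Longrightarrow> p \<in> S \<Longrightarrow> dominates S C p p"
  unfolding dominates_def using chain_pair_same by blast

text \<open>Both products are 0-1 matrices, since a row or column of \<open>C\<close> has at most one 1. That \<open>P C\<close> has no
  more ones than \<open>C P\<close> uses that \<open>p\<close> starts its chain; the converse uses that the chain of \<open>q\<close> stops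
  first.\<close>

lemma chain_pair_commutes:
  fixes C :: "'i::linorder \<Rightarrow> 'i \<Rightarrow> 'k::field"
  assumes S: "finite S" and C: "rook S C" and pq: "p \<in> S" "q \<in> S"
    and p: "row_free S C p" and dom: "dominates S C p q" and ij: "i \<in> S" "j \<in> S"
  defines "P \<equiv> \<lambda>i j. if chain_pair S C p q j i then 1 else (0::'k)"
  shows "(\<Sum>k\<in>S. P i k * C k j) = (\<Sum>k\<in>S. C i k * P k j)"
proof -
  have L: "(\<Sum>k\<in>S. P i k * C k j) = (if \<exists>k\<in>S. C k j \<noteq> 0 \<and> chain_pair S C p q k i then 1 else 0)"
  proof (cases "\<exists>k\<in>S. C k j \<noteq> 0")
    case True
    then obtain k where k: "k \<in> S" "C k j \<noteq> 0" by blast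
    have "(\<exists>l\<in>S. C l j \<noteq> 0 \<and> chain_pair S C p q l i) \<longleftrightarrow> chain_pair S C p q k i"
      using k ij rookD(4)[OF C] by blast
    then show ?thesis using rook_column_sum[OF S C ij(2) k, of "P i"] by (simp only: P_def)
  qed auto
  have R: "(\<Sum>k\<in>S. C i k * P k j) = (if \<exists>k\<in>S. C i k \<noteq> 0 \<and> chain_pair S C p q j k then 1 else 0)"
  proof (cases "\<exists>k\<in>S. C i k \<noteq> 0")
    case True
    then obtain k where k: "k \<in> S" "C i k \<noteq> 0" by blast
    have "(\<exists>l\<in>S. C i l \<noteq> 0 \<and> chain_pair S C p q j l) \<longleftrightarrow> chain_pair S C p q j k"
      using k ij rookD(3)[OF C] by blast
    then show ?thesis using rook_row_sum[OF S C ij(1) k, of "\<lambda>k. P k j"] by (simp only: P_def)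
  qed auto
  have "(\<exists>k\<in>S. C k j \<noteq> 0 \<and> chain_pair S C p q k i) \<longleftrightarrow> (\<exists>k\<in>S. C i k \<noteq> 0 \<and> chain_pair S C p q j k)"
  proof
    assume "\<exists>k\<in>S. C k j \<noteq> 0 \<and> chain_pair S C p q k i"
    then obtain k where k: "k \<in> S" "C k j \<noteq> 0" "chain_pair S C p q k i" by blast
    from k(3) show "\<exists>k\<in>S. C i k \<noteq> 0 \<and> chain_pair S C p q j k"
    proof cases
      case base
      then show ?thesis using p k ij by (auto simp: row_free_def)
    next
      case (step x y)
      have "x \<in> S" "y \<in> S" using chain_pair_in[OF step(1) pq] by auto
      moreover then have "x = j" using ij k step(4) rookD(3)[OF C] by blast
      ultimately show ?thesis using step by blast
    qed
  next
    assume "\<exists>k\<in>S. C i k \<noteq> 0 \<and> chain_pair S C p q j k"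
    then obtain k where k: "k \<in> S" "C i k \<noteq> 0" "chain_pair S C p q j k" by blast
    then obtain l where "l \<in> S" "C l j \<noteq> 0" using dom ij unfolding dominates_def by blast
    then show "\<exists>k\<in>S. C k j \<noteq> 0 \<and> chain_pair S C p q k i"
      using chain_pair.step[OF k(3) _ ij(1) _ k(2)] by blast
  qed
  then show ?thesis unfolding L R by simp
qed

text \<open>The matrix \<open>1 + c P\<close> lies in the commutant. On a column supported on tops of chains it acts only
  through the pair \<open>(p, q)\<close>, since the other pairs start below a top. With \<open>p = q\<close> it rescales
  one entry, because \<open>P\<close> is then the projection onto the chain of \<open>p\<close>.\<close>

lemma column_equiv_chain:
  fixes C :: "'i::linorder \<Rightarrow> 'i \<Rightarrow> 'k::field"
  assumes S: "finite S" and C: "rook S C" and pq: "p \<in> S" "q \<in> S"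
    and p: "row_free S C p" and dom: "dominates S C p q"
    and u: "\<And>i. i \<in> S \<Longrightarrow> u i \<noteq> 0 \<Longrightarrow> row_free S C i"
    and c: "p = q \<Longrightarrow> 1 + c \<noteq> 0"
  shows "column_equiv S C u (u(q := u q + c * u p))"
proof -
  define P where "P = (\<lambda>i j. if chain_pair S C p q j i then 1 else (0::'k))"
  define h where "h = (\<lambda>i j. id_fun i j + c * P i j)"
  have sums: "(\<Sum>k\<in>S. h i k * f k) = f i + c * (\<Sum>k\<in>S. P i k * f k)"
     "(\<Sum>k\<in>S. f k * h k i) = f i + c * (\<Sum>k\<in>S. f k * P k i)" if "i \<in> S" for i f
    unfolding h_def distrib_left distrib_right sum.distrib
      sum_id_fun_left[OF S that] sum_id_fun_right[OF S that]
    by (simp_all add: sum_distrib_left mult_ac)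
  show ?thesis
  proof (rule column_equivI)
    have "P i i = 0" if "p \<noteq> q" for i
      using that chain_pair_diagonal[OF _ C pq] unfolding P_def by auto
    moreover have "P i i = 0 \<or> P i i = 1" for i by (simp add: P_def)
    ultimately have "h i i = 1 \<or> p = q \<and> h i i = 1 + c" for i
      unfolding h_def by (metis add_0_right mult_1_right mult_zero_right)
    then have "h i i \<noteq> 0" for i using c by (metis one_neq_zero)
    moreover have "h i j = 0" if "j < i" for i j
      using that dom unfolding h_def P_def dominates_def by (auto dest: leD)
    ultimately show "tri_unit S h" by (simp add: tri_unit_def)
    show "intertwines S h C C"
      unfolding intertwines_def
    proof (intro ballI)
      fix i j assume ij: "i \<in> S" "j \<in> S"
      have "(\<Sum>k\<in>S. P i k * C k j) = (\<Sum>k\<in>S. C i k * P k j)"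
        using chain_pair_commutes[OF S C pq p dom ij] unfolding P_def .
      then show "(\<Sum>k\<in>S. h i k * C k j) = (\<Sum>k\<in>S. C i k * h k j)"
        unfolding sums(1)[OF ij(1)] sums(2)[OF ij(2)] by simp
    qed
    fix i assume i: "i \<in> S"
    have "P i k * u k = 0" if "k \<in> S" "k \<noteq> p \<or> i \<noteq> q" for k
    proof (cases "chain_pair S C p q k i \<and> u k \<noteq> 0")
      case True
      then have "row_free S C k" "chain_pair S C p q k i" using u that by auto
      from this(2) show ?thesis
      proof cases
        case base
        then show ?thesis using that by simp
      next
        case (step x y)
        then show ?thesis
          using \<open>row_free S C k\<close> chain_pair_in[OF step(1) pq] by (auto simp: row_free_def)
      qed
    qed (auto simp: P_def)
    then have "(\<Sum>k\<in>S. P i k * u k) = (\<Sum>k\<in>(if i = q then {p} else {}). P i k * u k)"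
      using S pq by (intro sum.mono_neutral_right) auto
    also have "\<dots> = (if i = q then u p else 0)"
      using chain_pair.base[of S C p q] by (auto simp: P_def)
    finally show "(\<Sum>k\<in>S. h i k * u k) = (\<Sum>k\<in>S. C i k * 0) + (u(q := u q + c * u p)) i"
      using i by (simp add: sums)
  qed
qed

text \<open>A representative minimizing the number of nonzero entries plus the number of entries outside
  \<open>{0, 1}\<close> is as wanted: an entry in a row of \<open>C\<close> with a 1 can be removed modulo the image of \<open>C\<close>, a
  nonzero entry can be rescaled to 1, and a dominated entry can be cleared by the dominating one.\<close>

lemma column_equiv_rook:
  fixes C :: "'i::linorder \<Rightarrow> 'i \<Rightarrow> 'k::field"
  assumes S: "finite S" and C: "rook S C"
  obtains u where "column_equiv S C v u" "\<And>i. i \<in> S \<Longrightarrow> u i \<in> {0, 1}"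
    "\<And>i. i \<in> S \<Longrightarrow> u i \<noteq> 0 \<Longrightarrow> row_free S C i"
    "\<And>p q. p \<in> S \<Longrightarrow> q \<in> S \<Longrightarrow> u p \<noteq> 0 \<Longrightarrow> u q \<noteq> 0 \<Longrightarrow> p \<noteq> q \<Longrightarrow> \<not> dominates S C p q"
proof -
  define f where "f u = card {i\<in>S. u i \<noteq> 0} + card {i\<in>S. u i \<notin> {0, 1}}" for u :: "'i \<Rightarrow> 'k"
  obtain u where u: "column_equiv S C v u" and min: "\<And>t. column_equiv S C v t \<Longrightarrow> f u \<le> f t"
    using ex_has_least_nat[of "column_equiv S C v" v f] column_equiv_refl[OF S, of C v] by blast
  have min': "f u \<le> f t" if "column_equiv S C u t" for t
    using min column_equiv_trans[OF S u that] by blast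
  have kill: "\<not> column_equiv S C u (u(i := 0))" if i: "i \<in> S" "u i \<noteq> 0" for i
  proof
    assume "column_equiv S C u (u(i := 0))"
    then have "f u \<le> f (u(i := 0))" by (rule min')
    moreover have "card {j\<in>S. (u(i := 0)) j \<noteq> 0} < card {j\<in>S. u j \<noteq> 0}"
      using S i by (intro psubset_card_mono) auto
    moreover have "card {j\<in>S. (u(i := 0)) j \<notin> {0, 1}} \<le> card {j\<in>S. u j \<notin> {0, 1}}"
      using S i by (intro card_mono) auto
    ultimately show False unfolding f_def by linarith
  qed
  have free: "row_free S C i" if i: "i \<in> S" "u i \<noteq> 0" for i
    unfolding row_free_def
  proof (intro ballI, rule ccontr)
    fix j assume j: "j \<in> S" "C i j \<noteq> 0"
    have C01: "C i j = 1" using rookD(2)[OF C i(1) j] .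
    have "column_equiv S C u (u(i := 0))"
    proof (rule column_equivI[OF tri_unit_id intertwines_id[OF S]])
      fix l assume l: "l \<in> S"
      have "(\<Sum>k\<in>S. C l k * (if k = j then u i else 0)) = C l j * u i"
        using S j by (simp add: if_distrib cong: if_cong)
      also have "\<dots> = (if l = i then u i else 0)"
        using C01 rookD(4)[OF C l i(1) j(1) _ j(2)] by (cases "l = i") auto
      finally show "(\<Sum>k\<in>S. id_fun l k * u k)
          = (\<Sum>k\<in>S. C l k * (if k = j then u i else 0)) + (u(i := 0)) l"
        using sum_id_fun_left[OF S l, of u] by simp
    qed
    then show False using kill i by blast
  qed
  show ?thesis
  proof (rule that[OF u])
    show "row_free S C i" if "i \<in> S" "u i \<noteq> 0" for i using free that .
    show "u i \<in> {0, 1}" if i: "i \<in> S" for i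
    proof (rule ccontr)
      assume ui: "u i \<notin> {0, 1}"
      have "column_equiv S C u (u(i := u i + (1 / u i - 1) * u i))"
        using ui free i by (intro column_equiv_chain S C dominates_refl) auto
      moreover have "u i + (1 / u i - 1) * u i = 1" using ui by (simp add: field_simps)
      ultimately have "f u \<le> f (u(i := 1))" using min' by simp
      moreover have "card {j\<in>S. (u(i := 1)) j \<notin> {0, 1}} < card {j\<in>S. u j \<notin> {0, 1}}"
        using S i ui by (intro psubset_card_mono) auto
      moreover have "card {j\<in>S. (u(i := 1)) j \<noteq> 0} = card {j\<in>S. u j \<noteq> 0}"
        using ui by (intro arg_cong[where f = card]) auto
      ultimately show False unfolding f_def by linarith
    qed
    fix p q assume pq: "p \<in> S" "q \<in> S" "u p \<noteq> 0" "u q \<noteq> 0" "p \<noteq> q"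
    show "\<not> dominates S C p q"
    proof
      assume "dominates S C p q"
      then have "column_equiv S C u (u(q := u q + (- u q / u p) * u p))"
        using pq free by (intro column_equiv_chain S C) auto
      then show False using kill pq by simp
    qed
  qed
qed

section \<open>Nilpotent normal forms in size at most five\<close>

text \<open>If the chain of \<open>p\<close> stopped at \<open>p\<close>, it would be a single vector, which every chain with a larger
  top dominates.\<close>

lemma incomparable_chains:
  fixes C :: "'i::linorder \<Rightarrow> 'i \<Rightarrow> 'k::field"
  assumes C: "rook S C" and pq: "p \<in> S" "q \<in> S" "p < q"
    and nd: "\<not> dominates S C q p"
  obtains r where "r \<in> S" "r < p" "C r p = 1"
proof -
  have "\<exists>r\<in>S. C r p \<noteq> 0"
  proof (rule ccontr)
    assume *: "\<not> (\<exists>r\<in>S. C r p \<noteq> 0)"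
    have "x = q \<and> y = p" if "chain_pair S C q p x y" for x y
      using that by (induction rule: chain_pair.induct) (use * in auto)
    then have "dominates S C q p"
      using * pq(3) unfolding dominates_def by (metis order_less_imp_le)
    then show False using nd by blast
  qed
  then show thesis using that rookD(1,2)[OF C _ pq(1)] by blast
qed

text \<open>The matrix with \<open>e\<^sub>m \<mapsto> e\<^sub>p + e\<^sub>q\<close> and \<open>e\<^sub>p \<mapsto> e\<^sub>r\<close>: the smallest
  nilpotent normal form that is not a rook placement.\<close>

definition branched :: "'i::linorder set \<Rightarrow> ('i \<Rightarrow> 'i \<Rightarrow> 'k::field) \<Rightarrow> bool" where
  "branched S C \<longleftrightarrow> (\<exists>r p q m. r < p \<and> p < q \<and> q < m \<and> S = {r, p, q, m} \<and>
     (\<forall>i\<in>S. \<forall>j\<in>S. C i j = (if (i, j) \<in> {(r, p), (p, m), (q, m)} then 1 else 0)))"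

text \<open>Two nonzero entries of the new column need incomparable tops \<open>p < q\<close>, hence a third index
  \<open>r < p\<close> in the chain of \<open>p\<close>. In size 3 these are all the indices, and \<open>C\<close> is determined.\<close>

lemma rook_border:
  fixes C :: "'i::linorder \<Rightarrow> 'i \<Rightarrow> 'k::field"
  assumes S: "finite S" "\<forall>i\<in>S. i < m" and C: "rook S C" and card: "card S \<le> 3"
    and u: "\<And>i. i \<in> S \<Longrightarrow> u i \<in> {0, 1}" "\<And>i. i \<in> S \<Longrightarrow> u i \<noteq> 0 \<Longrightarrow> row_free S C i"
    "\<And>p q. p \<in> S \<Longrightarrow> q \<in> S \<Longrightarrow> u p \<noteq> 0 \<Longrightarrow> u q \<noteq> 0 \<Longrightarrow> p \<noteq> q \<Longrightarrow> \<not> dominates S C p q"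
  shows "rook (insert m S) (border m C u 0) \<or> card S = 3 \<and> branched (insert m S) (border m C u 0)"
proof (cases "\<exists>p\<in>S. \<exists>q\<in>S. u p \<noteq> 0 \<and> u q \<noteq> 0 \<and> p < q")
  case True
  then obtain p q where pq: "p \<in> S" "q \<in> S" "u p \<noteq> 0" "u q \<noteq> 0" "p < q" by blast
  then have free: "row_free S C p" "row_free S C q" using u(2) by auto
  obtain r where r: "r \<in> S" "r < p" "C r p = 1"
    using incomparable_chains[OF C pq(1,2,5)] u(3) pq by (metis less_irrefl)
  have "r \<noteq> p" "r \<noteq> q" "p \<noteq> q" using r pq by auto
  then have "card {r, p, q} = 3" by simp
  moreover have sub: "{r, p, q} \<subseteq> S" using r pq by simp
  ultimately have Seq: "S = {r, p, q}" and c3: "card S = 3"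
    using card card_seteq[OF S(1) sub] by auto
  have rowr: "C r j = (if j = p then 1 else 0)" if "j \<in> S" for j
  proof -
    have "j = p" if "C r j \<noteq> 0" using that \<open>j \<in> S\<close> r pq rookD(3)[OF C r(1), of j p] by simp
    then show ?thesis using r by (cases "j = p") auto
  qed
  have ur: "u r = 0" using u(2)[OF r(1)] r(3) pq(1) by (metis one_neq_zero row_free_def)
  have "u p = 1" "u q = 1" using u(1) pq by auto
  then have "branched (insert m S) (border m C u 0)"
    unfolding branched_def
    using r pq S(2) ur rowr free
    by (intro exI[of _ r] exI[of _ p] exI[of _ q] exI[of _ m])
      (auto simp: Seq border_def row_free_def)
  then show ?thesis using c3 by blast
next
  case False
  then have single: "i = j" if "i \<in> S" "j \<in> S" "u i \<noteq> 0" "u j \<noteq> 0" for i j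
    using that by (metis linorder_neqE)
  have nz: "i \<in> S \<and> (j = m \<and> u i \<noteq> 0 \<or> j \<in> S \<and> C i j \<noteq> 0)"
    if "i \<in> insert m S" "j \<in> insert m S" "border m C u 0 i j \<noteq> 0" for i j
    using that by (auto simp: border_def split: if_splits)
  have m: "m \<notin> S" using S(2) by auto
  have "strict_upper (insert m S) (border m C u 0)"
    using nz S(2) rookD(1)[OF C] unfolding strict_upper_def by blast
  moreover have "zero_one (insert m S) (border m C u 0)"
    unfolding zero_one_def border_def using u(1) C by (auto simp: rook_def zero_one_def)
  moreover have "j = k"
    if "i \<in> insert m S" "j \<in> insert m S" "k \<in> insert m S"
      "border m C u 0 i j \<noteq> 0" "border m C u 0 i k \<noteq> 0" for i j k
    using nz[OF that(1,2,4)] nz[OF that(1,3,5)] u(2)[of i] rookD(3)[OF C] unfolding row_free_def by blast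
  moreover have "i = j"
    if "i \<in> insert m S" "j \<in> insert m S" "k \<in> insert m S"
      "border m C u 0 i k \<noteq> 0" "border m C u 0 j k \<noteq> 0" for i j k
    using nz[OF that(1,3,4)] nz[OF that(2,3,5)] single[of i j] m rookD(4)[OF C] by blast
  ultimately have "rook (insert m S) (border m C u 0)" unfolding rook_def by blast
  then show ?thesis by blast
qed

lemma strict_upper_border:
  fixes A :: "'i::linorder \<Rightarrow> 'i \<Rightarrow> 'k::field"
  assumes S: "finite S" "\<forall>i\<in>S. i < m" and A: "strict_upper (insert m S) A" and C: "tri_sim S A C"
  obtains v where "tri_sim (insert m S) A (border m C v 0)"
proof -
  obtain g where g: "tri_unit S g" "intertwines S g A C" using C unfolding tri_sim_def by auto
  have "tri_sim (insert m S) (border m A (\<lambda>i. A i m) 0) (border m C (\<lambda>i. \<Sum>k\<in>S. g i k * A k m) 0)"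
    by (rule tri_sim_border[OF S g one_neq_zero, where w = "\<lambda>_. 0"]) simp
  moreover have "border m A (\<lambda>i. A i m) 0 i j = A i j" if "i \<in> insert m S" "j \<in> insert m S" for i j
    using that A S(2) unfolding strict_upper_def border_def by (auto dest: order_less_asym)
  ultimately show thesis
    using that tri_sim_cong[of "insert m S" "border m A (\<lambda>i. A i m) 0" A "border m C (\<lambda>i. \<Sum>k\<in>S. g i k * A k m) 0"
        "border m C (\<lambda>i. \<Sum>k\<in>S. g i k * A k m) 0"] by blast
qed

lemma nilpotent_tri_sim_rook_or_branched:
  fixes A :: "'i::linorder \<Rightarrow> 'i \<Rightarrow> 'k::field"
  assumes "finite S" "card S \<le> 4" "strict_upper S A"
  shows "\<exists>C. tri_sim S A C \<and> (rook S C \<or> card S = 4 \<and> branched S C)"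
  using assms
proof (induction S rule: finite_linorder_max_induct)
  case empty
  then show ?case
    using tri_sim_refl[of "{}" A] by (auto simp: rook_def strict_upper_def zero_one_def)
next
  case (insert m S)
  have S: "finite S" "\<forall>i\<in>S. i < m" and m: "m \<notin> S" and c: "card S \<le> 3"
    using insert by auto
  moreover have "strict_upper S A" using insert.prems by (auto simp: strict_upper_def)
  ultimately obtain C where C: "tri_sim S A C" "rook S C"
    using insert.IH by auto
  obtain v where v: "tri_sim (insert m S) A (border m C v 0)"
    using strict_upper_border[OF S insert.prems(2) C(1)] .
  obtain u where u: "column_equiv S C v u" "\<And>i. i \<in> S \<Longrightarrow> u i \<in> {0, 1}"
    "\<And>i. i \<in> S \<Longrightarrow> u i \<noteq> 0 \<Longrightarrow> row_free S C i"
    "\<And>p q. p \<in> S \<Longrightarrow> q \<in> S \<Longrightarrow> u p \<noteq> 0 \<Longrightarrow> u q \<noteq> 0 \<Longrightarrow> p \<noteq> q \<Longrightarrow> \<not> dominates S C p q"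
    by (rule column_equiv_rook[OF S(1) C(2), of v]) blast
  have "tri_sim (insert m S) A (border m C u 0)"
    by (rule tri_sim_trans[OF _ v column_equiv_border[OF S u(1)]]) (use S(1) in simp)
  moreover have "rook (insert m S) (border m C u 0) \<or> card S = 3 \<and> branched (insert m S) (border m C u 0)"
    by (rule rook_border[OF S C(2) c u(2-4)])
  moreover have "card (insert m S) = Suc (card S)" using S(1) m by simp
  ultimately show ?case by (intro exI[of _ "border m C u 0"]) simp
qed

text \<open>The commutant contains the matrix sending \<open>e\<^sub>m\<close> to \<open>e\<^sub>p\<close> and \<open>e\<^sub>q\<close> to
  \<open>e\<^sub>r\<close>, and the cokernel of \<open>C\<close> is spanned by \<open>e\<^sub>m\<close> and \<open>e\<^sub>q = - e\<^sub>p\<close>. So a nonzero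
  \<open>m\<close>-entry clears everything else, and only the difference of the \<open>q\<close>- and \<open>p\<close>-entries matters
  otherwise; scalars normalize what remains to 1.\<close>

lemma column_equiv_branched:
  fixes C :: "'i::linorder \<Rightarrow> 'i \<Rightarrow> 'k::field"
  assumes "branched S C"
  obtains u where "column_equiv S C v u" "\<And>i. i \<in> S \<Longrightarrow> u i \<in> {0, 1}"
proof -
  obtain r p q m where o: "r < p" "p < q" "q < m" and Seq: "S = {r, p, q, m}"
    and Cent: "\<And>i j. i \<in> S \<Longrightarrow> j \<in> S \<Longrightarrow> C i j = (if (i, j) \<in> {(r, p), (p, m), (q, m)} then 1 else 0)"
    using assms unfolding branched_def by blast
  have ne: "r \<noteq> p" "r \<noteq> q" "r \<noteq> m" "p \<noteq> q" "p \<noteq> m" "q \<noteq> m" using o by auto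
  note ne' = ne ne[symmetric]
  have sum: "(\<Sum>k\<in>S. f k) = f r + f p + f q + f m" for f :: "'i \<Rightarrow> 'k"
    using ne by (simp add: Seq)
  have ord: "\<not> p < r" "\<not> q < r" "\<not> m < r" "\<not> q < p" "\<not> m < p" "\<not> m < q" using o by auto
  have Cval: "C r p = 1" "C p m = 1" "C q m = 1"
    "C r r = 0" "C r q = 0" "C r m = 0" "C p r = 0" "C p p = 0" "C p q = 0"
    "C q r = 0" "C q p = 0" "C q q = 0" "C m r = 0" "C m p = 0" "C m q = 0" "C m m = 0"
    using ne' by (auto simp: Cent Seq)
  define g where "g a b = (\<lambda>i j. if i = j then a
      else if (i, j) \<in> {(p, m), (r, q)} then a * b else 0)" for a b :: 'k
  have gval: "g a b r r = a" "g a b p p = a" "g a b q q = a" "g a b m m = a"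
    "g a b p m = a * b" "g a b r q = a * b" "g a b r p = 0" "g a b r m = 0" "g a b p q = 0" "g a b q m = 0"
    "g a b p r = 0" "g a b q r = 0" "g a b m r = 0" "g a b q p = 0" "g a b m p = 0" "g a b m q = 0" for a b
    using ne' by (auto simp: g_def)
  have g: "tri_unit S (g a b)" "intertwines S (g a b) C C" if "a \<noteq> 0" for a b
    using that o ord unfolding tri_unit_def intertwines_def sum
    by (simp_all add: Seq gval Cval)
  show thesis
  proof (cases "v m = 0")
    case False
    \<comment> \<open>Dividing by \<open>v m\<close> makes the \<open>m\<close>-entry 1. The coefficient \<open>(v q - v p) / v m\<close>
      makes the \<open>p\<close>- and \<open>q\<close>-entries equal, hence a multiple of the column \<open>C e\<^sub>m\<close>; \<open>w\<close> removes that
      multiple and the \<open>r\<close>-entry.\<close>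
    define w where "w = (\<lambda>i. if i = p then (v r + (v q - v p) / v m * v q) / v m
        else if i = m then v q / v m else 0)"
    have w: "w p = (v r + (v q - v p) / v m * v q) / v m" "w m = v q / v m" "w r = 0" "w q = 0"
      using ne' by (auto simp: w_def)
    have "column_equiv S C v (\<lambda>i. if i = m then 1 else 0)"
    proof (rule column_equivI[OF g])
      show "1 / v m \<noteq> 0" "1 / v m \<noteq> 0" using False by simp_all
      show "(\<Sum>k\<in>S. g (1 / v m) ((v q - v p) / v m) i k * v k)
          = (\<Sum>k\<in>S. C i k * w k) + (if i = m then 1 else 0)" if "i \<in> S" for i
        using that False ne' unfolding sum by (auto simp: Seq gval Cval w field_simps)
    qed
    then show thesis using that by simp
  next
    case vm: True
    define c where "c = (if v q = v p then 1 else v q - v p)"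
    have c: "c \<noteq> 0" by (simp add: c_def)
    define w where "w = (\<lambda>i. if i = p then v r / c else if i = m then v p / c else 0)"
    have w: "w p = v r / c" "w m = v p / c" "w r = 0" "w q = 0"
      using ne' by (auto simp: w_def)
    define u where "u = (\<lambda>i. if i = q \<and> v q \<noteq> v p then 1 else 0 :: 'k)"
    have u: "u r = 0" "u p = 0" "u m = 0" "u q = (v q - v p) / c" using ne by (auto simp: u_def c_def)
    have "column_equiv S C v u"
    proof (rule column_equivI[OF g])
      show "1 / c \<noteq> 0" "1 / c \<noteq> 0" using c by simp_all
      show "(\<Sum>k\<in>S. g (1 / c) 0 i k * v k) = (\<Sum>k\<in>S. C i k * w k) + u i" if "i \<in> S" for i
        using that c ne' unfolding sum by (auto simp: Seq gval Cval w u vm field_simps)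
    qed
    then show thesis using that by (simp add: u_def)
  qed
qed

lemma nilpotent_tri_sim_zero_one:
  fixes A :: "'i::linorder \<Rightarrow> 'i \<Rightarrow> 'k::field"
  assumes S: "finite S" and card: "card S \<le> 5" and A: "strict_upper S A"
  shows "\<exists>C. tri_sim S A C \<and> strict_upper S C \<and> zero_one S C"
proof -
  have small: "strict_upper T D \<and> zero_one T D" if "rook T D \<or> branched T D" for T :: "'i set" and D :: "'i \<Rightarrow> 'i \<Rightarrow> 'k"
    using that
  proof
    assume "branched T D"
    then obtain r p q m where o: "r < p" "p < q" "q < m"
      and D: "\<And>i j. i \<in> T \<Longrightarrow> j \<in> T \<Longrightarrow> D i j = (if (i, j) \<in> {(r, p), (p, m), (q, m)} then 1 else 0)"
      unfolding branched_def by blast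
    have "i < j" if "(i, j) \<in> {(r, p), (p, m), (q, m)}" for i j
      using that o by auto
    then show ?thesis unfolding strict_upper_def zero_one_def
      by (metis D insertCI)
  qed (simp add: rook_def)
  show ?thesis
  proof (cases "card S \<le> 4")
    case True
    then show ?thesis using nilpotent_tri_sim_rook_or_branched[OF S True A] small by blast
  next
    case False
    define m where "m = Max S"
    define T where "T = S - {m}"
    have ne: "S \<noteq> {}" using False by auto
    have m: "m \<in> S" using Max_in[OF S ne] by (simp add: m_def)
    have T: "finite T" "\<forall>i\<in>T. i < m" "S = insert m T" and cT: "card T \<le> 4"
      using S m Max_ge[OF S] card unfolding T_def m_def by (auto simp: order_less_le)
    have "strict_upper T A" using A by (auto simp: T_def strict_upper_def)
    then obtain C where C: "tri_sim T A C" "rook T C \<or> branched T C"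
      using nilpotent_tri_sim_rook_or_branched[OF T(1) cT] by blast
    obtain v where v: "tri_sim S A (border m C v 0)"
      using strict_upper_border[OF T(1,2) _ C(1)] A unfolding T(3) by blast
    obtain u where u: "column_equiv T C v u" "\<And>i. i \<in> T \<Longrightarrow> u i \<in> {0, 1}"
      using C(2)
    proof
      assume "rook T C"
      show thesis by (rule column_equiv_rook[OF T(1) \<open>rook T C\<close>, of v]) (rule that)
    next
      assume "branched T C"
      show thesis by (rule column_equiv_branched[OF \<open>branched T C\<close>, of v]) (rule that)
    qed
    have "tri_sim S A (border m C u 0)"
      by (rule tri_sim_trans[OF S v]) (use column_equiv_border[OF T(1,2) u(1)] in \<open>simp only: T(3)\<close>)
    moreover have "strict_upper S (border m C u 0)" "zero_one S (border m C u 0)"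
      using small[OF C(2)] u(2) T(2) unfolding T(3) strict_upper_def zero_one_def border_def by auto
    ultimately show ?thesis by blast
  qed
qed

section \<open>The normal form and its commutant\<close>

definition normal_form :: "'i::linorder set \<Rightarrow> ('i \<Rightarrow> 'i \<Rightarrow> 'k::field) \<Rightarrow> bool" where
  "normal_form S C \<longleftrightarrow> separated S C \<and> (\<forall>i\<in>S. \<forall>j\<in>S. i \<noteq> j \<longrightarrow> C i j \<in> {0, 1})"

text \<open>After separation the matrix is block diagonal with respect to the sets \<open>T d\<close> of indices with
  eigenvalue \<open>d\<close>, up to a permutation that is never carried out. The conjugators and the normal forms of
  the nilpotent parts are glued along these sets.\<close>

lemma tri_sim_normal_form:
  fixes A :: "'i::linorder \<Rightarrow> 'i \<Rightarrow> 'k::field"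
  assumes S: "finite S" and card: "card S \<le> 5" and A: "\<forall>i\<in>S. \<forall>j\<in>S. j < i \<longrightarrow> A i j = 0"
  shows "\<exists>C. tri_sim S A C \<and> normal_form S C"
proof -
  obtain B where AB: "tri_sim S A B" and B: "separated S B"
    using tri_sim_separated[OF S A] by blast
  define N where "N i j = (if i = j then 0 else B i j)" for i j
  define T where "T d = {i \<in> S. B i i = d}" for d
  have T: "finite (T d)" "card (T d) \<le> 5" "T d \<subseteq> S" for d
    using S card card_mono[of S "T d"] by (auto simp: T_def)
  have "strict_upper (T d) N" for d
    using B by (auto simp: strict_upper_def separated_def N_def T_def order_less_le)
  then have "\<forall>d. \<exists>C g. tri_unit (T d) g \<and> intertwines (T d) g N C \<and> strict_upper (T d) C \<and> zero_one (T d) C"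
    using nilpotent_tri_sim_zero_one[OF T(1,2)] unfolding tri_sim_def by meson
  then obtain C g where g: "\<And>d. tri_unit (T d) (g d)" "\<And>d. intertwines (T d) (g d) N (C d)"
    and C: "\<And>d. strict_upper (T d) (C d)" "\<And>d. zero_one (T d) (C d)"
    by metis
  define h where "h i j = (if B i i = B j j then g (B i i) i j else 0)" for i j
  define D where "D i j = (if i = j then B i i else if B i i = B j j then C (B i i) i j else 0)" for i j
  have inT: "i \<in> T (B i i)" if "i \<in> S" for i using that by (simp add: T_def)
  have Cdiag: "C (B i i) i i = 0" if "i \<in> S" for i
    using C(1) inT[OF that] by (auto simp: strict_upper_def)
  have restrict: "(\<Sum>k\<in>S. E k) = (\<Sum>k\<in>T d. E k)" if "\<And>k. k \<in> S \<Longrightarrow> B k k \<noteq> d \<Longrightarrow> E k = 0" for E :: "'i \<Rightarrow> 'k" and d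
    using S that by (intro sum.mono_neutral_right) (auto simp: T_def)
  have "intertwines S h B D"
    unfolding intertwines_def
  proof (intro ballI)
    fix i j assume ij: "i \<in> S" "j \<in> S"
    let ?d = "B i i"
    have L: "(\<Sum>k\<in>S. h i k * B k j) = (\<Sum>k\<in>T ?d. h i k * B k j)"
      by (rule restrict) (simp add: h_def)
    have R: "(\<Sum>k\<in>S. D i k * h k j) = (\<Sum>k\<in>T ?d. D i k * h k j)"
      by (rule restrict) (auto simp: D_def)
    show "(\<Sum>k\<in>S. h i k * B k j) = (\<Sum>k\<in>S. D i k * h k j)"
    proof (cases "B j j = ?d")
      case False
      have "h i k * B k j = 0" "D i k * h k j = 0" if "k \<in> T ?d" for k
        using that False B ij by (auto simp: T_def separated_def h_def)
      then have "(\<Sum>k\<in>T ?d. h i k * B k j) = 0" "(\<Sum>k\<in>T ?d. D i k * h k j) = 0"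
        by (auto intro!: sum.neutral)
      then show ?thesis unfolding L R by simp
    next
      case True
      then have jT: "j \<in> T ?d" and iT: "i \<in> T ?d" using ij by (simp_all add: T_def)
      have "(\<Sum>k\<in>T ?d. h i k * B k j) = (\<Sum>k\<in>T ?d. g ?d i k * N k j + (if k = j then g ?d i j * ?d else 0))"
      proof (rule sum.cong)
        fix k assume "k \<in> T ?d"
        then have "B k k = ?d" by (simp add: T_def)
        then show "h i k * B k j = g ?d i k * N k j + (if k = j then g ?d i j * ?d else 0)"
          by (cases "k = j") (simp_all add: h_def N_def)
      qed simp
      also have "\<dots> = (\<Sum>k\<in>T ?d. g ?d i k * N k j) + g ?d i j * ?d"
        using T(1) jT by (simp add: sum.distrib)
      also have "\<dots> = (\<Sum>k\<in>T ?d. C ?d i k * g ?d k j) + g ?d i j * ?d"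
        using g(2)[of ?d] iT jT by (simp add: intertwines_def)
      also have "\<dots> = (\<Sum>k\<in>T ?d. C ?d i k * g ?d k j + (if k = i then g ?d i j * ?d else 0))"
        using T(1) iT by (simp add: sum.distrib)
      also have "\<dots> = (\<Sum>k\<in>T ?d. D i k * h k j)"
      proof (rule sum.cong)
        fix k assume "k \<in> T ?d"
        then have "B k k = ?d" by (simp add: T_def)
        then show "C ?d i k * g ?d k j + (if k = i then g ?d i j * ?d else 0) = D i k * h k j"
          using True Cdiag[OF ij(1)] by (cases "k = i") (simp_all add: h_def D_def)
      qed simp
      finally show ?thesis unfolding L R .
    qed
  qed
  moreover have "tri_unit S h"
    unfolding tri_unit_def
  proof (intro conjI ballI impI)
    show "h i i \<noteq> 0" if "i \<in> S" for i
      using g(1)[of "B i i"] inT[OF that] by (auto simp: h_def tri_unit_def)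
    show "h i j = 0" if "i \<in> S" "j \<in> S" "j < i" for i j
      using g(1)[of "B i i"] inT[OF that(1)] that by (auto simp: h_def tri_unit_def T_def)
  qed
  ultimately have "tri_sim S B D" unfolding tri_sim_def by blast
  moreover have "normal_form S D"
    unfolding normal_form_def separated_def
  proof (intro conjI ballI impI)
    fix i j assume ij: "i \<in> S" "j \<in> S"
    have jT: "j \<in> T (B i i)" if "B i i = B j j" using that ij by (simp add: T_def)
    show "D i j \<in> {0, 1}" if "i \<noteq> j"
    proof (cases "B i i = B j j")
      case True
      then have "D i j = C (B i i) i j" using that by (simp add: D_def)
      then show ?thesis using C(2)[of "B i i"] inT[OF ij(1)] jT[OF True] unfolding zero_one_def by metis
    qed (use that in \<open>simp add: D_def\<close>)
    assume nz: "D i j \<noteq> 0"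
    then have eq: "B i i = B j j" by (metis D_def)
    then show "D i i = D j j" by (simp add: D_def)
    show "i \<le> j"
    proof (cases "i = j")
      case False
      then have "C (B i i) i j \<noteq> 0" using nz by (metis D_def)
      then show ?thesis
        using C(1)[of "B i i"] inT[OF ij(1)] jT[OF eq] unfolding strict_upper_def
        by (metis order_less_imp_le)
    qed simp
  qed
  ultimately show ?thesis using tri_sim_trans[OF S AB, of D] by blast
qed

text \<open>The \<open>(i, j)\<close> entry of \<open>Y C = C Y\<close> reads \<open>(C j j - C i i) Y i j\<close> plus products whose \<open>Y\<close> factor
  lies in a shorter interval of indices and again joins different eigenvalues; so the entries vanish by
  induction on the length of the interval.\<close>

lemma commuting_separated_block:
  fixes C :: "'i::linorder \<Rightarrow> 'i \<Rightarrow> 'k::field"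
  assumes S: "finite S" and C: "separated S C" and Y: "intertwines S Y C C"
    and tri: "\<forall>i\<in>S. \<forall>j\<in>S. j < i \<longrightarrow> Y i j = 0"
  shows "i \<in> S \<Longrightarrow> j \<in> S \<Longrightarrow> C i i \<noteq> C j j \<Longrightarrow> Y i j = 0"
proof (induction "card {k\<in>S. i \<le> k \<and> k \<le> j}" arbitrary: i j rule: less_induct)
  case less
  have IH: "Y i' j' = 0"
    if "i' \<in> S" "j' \<in> S" "C i' i' \<noteq> C j' j'" "i \<le> i'" "j' \<le> j" "i \<noteq> i' \<or> j' \<noteq> j" "i \<le> j" for i' j'
  proof (rule less.hyps)
    have "(if i \<noteq> i' then i else j) \<in> {k\<in>S. i \<le> k \<and> k \<le> j} - {k\<in>S. i' \<le> k \<and> k \<le> j'}"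
      using that less.prems by auto
    moreover have "{k\<in>S. i' \<le> k \<and> k \<le> j'} \<subseteq> {k\<in>S. i \<le> k \<and> k \<le> j}" using that by auto
    ultimately have "{k\<in>S. i' \<le> k \<and> k \<le> j'} \<subset> {k\<in>S. i \<le> k \<and> k \<le> j}" by blast
    then show "card {k\<in>S. i' \<le> k \<and> k \<le> j'} < card {k\<in>S. i \<le> k \<and> k \<le> j}"
      by (rule psubset_card_mono[rotated]) (use S in simp)
  qed (use that in auto)
  show ?case
  proof (cases "j < i")
    case True
    then show ?thesis using tri less.prems by blast
  next
    case False
    then have ij: "i \<le> j" by simp
    have "Y i k * C k j = 0" if k: "k \<in> S" "k \<noteq> j" for k
    proof (cases "C k j = 0")
      case False
      then have "C k k = C j j" "k \<le> j" using C k less.prems unfolding separated_def by blast+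
      then show ?thesis using IH[of i k] less.prems k ij by simp
    qed simp
    then have "(\<Sum>k\<in>S. Y i k * C k j) = (\<Sum>k\<in>{j}. Y i k * C k j)"
      using S less.prems by (intro sum.mono_neutral_right) auto
    moreover have "C i k * Y k j = 0" if k: "k \<in> S" "k \<noteq> i" for k
    proof (cases "C i k = 0")
      case False
      then have "C k k = C i i" "i \<le> k" using C k less.prems unfolding separated_def by fastforce+
      then show ?thesis using IH[of k j] less.prems k ij by simp
    qed simp
    then have "(\<Sum>k\<in>S. C i k * Y k j) = (\<Sum>k\<in>{i}. C i k * Y k j)"
      using S less.prems by (intro sum.mono_neutral_right) auto
    ultimately have "Y i j * C j j = C i i * Y i j"
      using Y less.prems unfolding intertwines_def by simp
    then show ?thesis using less.prems by (simp add: mult.commute)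
  qed
qed

text \<open>Replacing the diagonal changes \<open>Y C - C Y\<close> at \<open>(i, j)\<close> by a multiple of \<open>Y i j\<close> that
  vanishes when the old eigenvalues agree, while \<open>Y i j\<close> itself vanishes when they differ.\<close>

lemma commutant_same_pattern:
  fixes C C' :: "'i::linorder \<Rightarrow> 'i \<Rightarrow> 'k::field"
  assumes S: "finite S" and C: "separated S C" and Y: "intertwines S Y C C"
    and tri: "\<forall>i\<in>S. \<forall>j\<in>S. j < i \<longrightarrow> Y i j = 0"
    and off: "\<And>i j. i \<in> S \<Longrightarrow> j \<in> S \<Longrightarrow> i \<noteq> j \<Longrightarrow> C' i j = C i j"
    and eq: "\<And>i j. i \<in> S \<Longrightarrow> j \<in> S \<Longrightarrow> C i i = C j j \<Longrightarrow> C' i i = C' j j"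
  shows "intertwines S Y C' C'"
  unfolding intertwines_def
proof (intro ballI)
  fix i j assume ij: "i \<in> S" "j \<in> S"
  have "(\<Sum>k\<in>S. Y i k * C' k j) = (\<Sum>k\<in>S. Y i k * C k j + (if k = j then Y i j * (C' j j - C j j) else 0))"
    using off ij by (intro sum.cong) (auto simp: algebra_simps)
  also have "\<dots> = (\<Sum>k\<in>S. Y i k * C k j) + Y i j * (C' j j - C j j)"
    using S ij by (simp add: sum.distrib)
  also have "\<dots> = (\<Sum>k\<in>S. C i k * Y k j) + Y i j * (C' i i - C i i)"
    using Y ij eq[OF ij] commuting_separated_block[OF S C Y tri ij]
    by (cases "C i i = C j j") (simp_all add: intertwines_def)
  also have "\<dots> = (\<Sum>k\<in>S. C i k * Y k j + (if k = i then Y i j * (C' i i - C i i) else 0))"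
    using S ij by (simp add: sum.distrib)
  also have "\<dots> = (\<Sum>k\<in>S. C' i k * Y k j)"
    using off ij by (intro sum.cong) (auto simp: algebra_simps)
  finally show "(\<Sum>k\<in>S. Y i k * C' k j) = (\<Sum>k\<in>S. C' i k * Y k j)" .
qed

section \<open>Centralizers and z-classes up to conjugation\<close>

lemma (in group) z_equivalence_if_conjugate:
  assumes x: "x \<in> carrier G" "y \<in> carrier G" "g \<in> carrier G" and gx: "g \<otimes> x = y \<otimes> g"
  shows "(x, y) \<in> z_equivalence G"
proof -
  have y: "y = g \<otimes> x \<otimes> inv g" using x gx by (simp add: m_assoc)
  have x': "x = inv g \<otimes> y \<otimes> g" using x gx by (metis inv_solve_left m_assoc m_closed inv_closed)
  have "centralizer G y = g <# centralizer G x #> inv g"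
  proof (intro equalityI subsetI)
    fix z assume "z \<in> centralizer G y"
    then have z: "z \<in> carrier G" "y \<otimes> z = z \<otimes> y" by (auto simp: centralizer_def)
    define w where "w = inv g \<otimes> z \<otimes> g"
    have zw: "z = g \<otimes> w \<otimes> inv g" using x z by (simp add: w_def m_assoc[symmetric]) (simp add: m_assoc)
    have "x \<otimes> w = inv g \<otimes> (y \<otimes> z) \<otimes> g"
      using x z by (simp add: x' w_def m_assoc) (simp add: m_assoc[symmetric])
    also have "\<dots> = w \<otimes> x"
      using x z by (simp add: x' w_def m_assoc z(2)) (simp add: m_assoc[symmetric])
    finally have "w \<in> centralizer G x" using x z by (simp add: centralizer_def w_def)
    then show "z \<in> g <# centralizer G x #> inv g"
      unfolding l_coset_def r_coset_def using zw by blast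
  next
    fix z assume "z \<in> g <# centralizer G x #> inv g"
    then obtain w where w: "w \<in> carrier G" "x \<otimes> w = w \<otimes> x" and z: "z = g \<otimes> w \<otimes> inv g"
      unfolding l_coset_def r_coset_def centralizer_def by blast
    have "y \<otimes> z = g \<otimes> (x \<otimes> w) \<otimes> inv g"
      using x w by (simp add: y z m_assoc) (simp add: m_assoc[symmetric])
    also have "\<dots> = z \<otimes> y"
      using x w by (simp add: y z m_assoc w(2)) (simp add: m_assoc[symmetric])
    finally show "z \<in> centralizer G y" using x w by (simp add: centralizer_def z)
  qed
  then show ?thesis using x by (auto simp: z_equivalence_def)
qed

text \<open>A z-class is determined by the centralizer of any of its members, so finitely many centralizers of
  representatives leave finitely many classes.\<close>

lemma (in group) finite_z_classes:
  assumes "finite (centralizer G ` X)" and X: "\<And>x. x \<in> carrier G \<Longrightarrow> \<exists>y\<in>X. y \<in> carrier G \<and> (x, y) \<in> z_equivalence G"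
  shows "finite (z_classes G)"
proof -
  define K where "K Z = {w \<in> carrier G. \<exists>g \<in> carrier G. centralizer G w = g <# Z #> inv g}" for Z
  have K: "z_equivalence G `` {y} = K (centralizer G y)" if "y \<in> carrier G" for y
    using that by (auto simp: K_def z_equivalence_def)
  have "z_classes G \<subseteq> K ` (centralizer G ` X)"
  proof
    fix c assume "c \<in> z_classes G"
    then obtain x where x: "x \<in> carrier G" "c = z_equivalence G `` {x}"
      unfolding z_classes_def by (rule quotientE)
    then obtain y where y: "y \<in> X" "y \<in> carrier G" "(x, y) \<in> z_equivalence G" using X by blast
    then have "c = z_equivalence G `` {y}"
      using equiv_class_eq[OF equiv_z_equivalence] x by blast
    then show "c \<in> K ` (centralizer G ` X)" using K y by blast
  qed
  then show ?thesis using assms(1) by (meson finite_imageI finite_subset)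
qed

section \<open>Finiteness in size at most five\<close>

lemma upper_GL_mult: "A \<otimes>\<^bsub>upper_GL TYPE('k::field) n\<^esub> B = A * B"
  by (simp add: upper_GL_def GL_def units_of_def ring_mat_simps)

lemma carrier_upper_GL:
  "A \<in> carrier (upper_GL TYPE('k::field) n) \<longleftrightarrow>
     A \<in> carrier_mat n n \<and> upper_triangular A \<and> (\<forall>i<n. A $$ (i, i) \<noteq> 0)"
proof -
  have "A \<in> carrier (upper_GL TYPE('k) n) \<longleftrightarrow> A \<in> carrier_mat n n \<and> upper_triangular A \<and> det A \<noteq> 0"
    using det_non_zero_imp_unit[of A n "()"] unit_imp_det_non_zero[of A n "()"]
    by (auto simp: upper_GL_def GL_def units_of_def Units_def ring_mat_simps)
  also have "\<dots> \<longleftrightarrow> A \<in> carrier_mat n n \<and> upper_triangular A \<and> (\<forall>i<n. A $$ (i, i) \<noteq> 0)"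
    using det_upper_triangular[of A n] by (auto simp: diag_mat_def prod_list_zero_iff)
  finally show ?thesis .
qed

lemma mult_eq_iff_intertwines:
  assumes "A \<in> carrier_mat n n" "C \<in> carrier_mat n n" "g \<in> carrier_mat n n"
  shows "g * A = C * g \<longleftrightarrow>
    intertwines {..<n} (\<lambda>i j. g $$ (i, j)) (\<lambda>i j. A $$ (i, j)) (\<lambda>i j. C $$ (i, j))"
  using assms
  by (auto simp: mat_eq_iff intertwines_def scalar_prod_def lessThan_atLeast0)

lemma finite_image_if_factors:
  assumes "finite (p ` X)" and "\<And>x y. x \<in> X \<Longrightarrow> y \<in> X \<Longrightarrow> p x = p y \<Longrightarrow> f x = f y"
  shows "finite (f ` X)"
proof -
  have "f x = f (inv_into X p (p x))" if "x \<in> X" for x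
    using assms(2)[OF that inv_into_into[of "p x" p X]] that f_inv_into_f[of "p x" p X] by auto
  then have "f ` X \<subseteq> (\<lambda>s. f (inv_into X p s)) ` p ` X" by blast
  then show ?thesis using assms(1) by (meson finite_imageI finite_subset)
qed

theorem finite_z_classes_upper_GL:
  assumes n: "n \<le> 5"
  shows "finite (z_classes (upper_GL TYPE('k::field) n))"
proof -
  let ?G = "upper_GL TYPE('k) n"
  let ?S = "{..<n}"
  define fun_of where "fun_of A = (\<lambda>i j. A $$ (i, j))" for A :: "'k mat"
  define X where "X = {A \<in> carrier ?G. normal_form ?S (fun_of A)}"
  define pattern where "pattern A = ({(i, j) \<in> ?S \<times> ?S. i \<noteq> j \<and> A $$ (i, j) = 1},
      {(i, j) \<in> ?S \<times> ?S. A $$ (i, i) = A $$ (j, j)})" for A :: "'k mat"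
  interpret group ?G by (rule group_upper_GL)
  show ?thesis
  proof (rule finite_z_classes)
    have "pattern ` X \<subseteq> Pow (?S \<times> ?S) \<times> Pow (?S \<times> ?S)" by (auto simp: pattern_def)
    then have fin: "finite (pattern ` X)" by (rule finite_subset) simp
    have sub: "centralizer ?G A \<subseteq> centralizer ?G B"
      if A: "A \<in> X" and B: "B \<in> X" and eq: "pattern A = pattern B" for A B
    proof
      fix Y assume "Y \<in> centralizer ?G A"
      then have Y: "Y \<in> carrier ?G" "A * Y = Y * A"
        by (auto simp: centralizer_def upper_GL_mult)
      have mats: "A \<in> carrier_mat n n" "B \<in> carrier_mat n n" "Y \<in> carrier_mat n n"
        using A B Y by (auto simp: X_def carrier_upper_GL)
      have "intertwines ?S (fun_of Y) (fun_of B) (fun_of B)"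
      proof (rule commutant_same_pattern)
        show "finite ?S" by simp
        show "separated ?S (fun_of A)" using A by (simp add: X_def normal_form_def)
        show "intertwines ?S (fun_of Y) (fun_of A) (fun_of A)"
          using mult_eq_iff_intertwines[OF mats(1,1,3)] Y(2) by (simp add: fun_of_def)
        show "\<forall>i\<in>?S. \<forall>j\<in>?S. j < i \<longrightarrow> fun_of Y i j = 0"
          using Y(1) by (auto simp: carrier_upper_GL fun_of_def)
        show "fun_of B i j = fun_of A i j" if ij: "i \<in> ?S" "j \<in> ?S" "i \<noteq> j" for i j
        proof -
          have "fun_of A i j \<in> {0, 1}" "fun_of B i j \<in> {0, 1}"
            using A B ij by (auto simp: X_def normal_form_def)
          moreover have "fun_of A i j = 1 \<longleftrightarrow> fun_of B i j = 1"
            using eq ij unfolding pattern_def fun_of_def by (auto simp: set_eq_iff)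
          ultimately show ?thesis by auto
        qed
        show "fun_of B i i = fun_of B j j" if "i \<in> ?S" "j \<in> ?S" "fun_of A i i = fun_of A j j" for i j
          using eq that unfolding pattern_def fun_of_def by (auto simp: set_eq_iff)
      qed
      then have "Y * B = B * Y"
        using mult_eq_iff_intertwines[OF mats(2,2,3)] by (simp add: fun_of_def)
      then show "Y \<in> centralizer ?G B"
        using Y(1) by (auto simp: centralizer_def upper_GL_mult)
    qed
    show "finite (centralizer ?G ` X)"
      by (rule finite_image_if_factors[OF fin], rule subset_antisym; rule sub) simp_all
  next
    fix A assume A: "A \<in> carrier ?G"
    then have "\<forall>i\<in>?S. \<forall>j\<in>?S. j < i \<longrightarrow> fun_of A i j = 0"
      by (auto simp: carrier_upper_GL fun_of_def)
    then obtain C g where g: "tri_unit ?S g" "intertwines ?S g (fun_of A) C" and C: "normal_form ?S C"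
      using tri_sim_normal_form[of ?S "fun_of A"] n unfolding tri_sim_def by auto
    \<comment> \<open>The normal form is invertible because it equals \<open>g' A g'\<inverse>\<close>.\<close>
    define g' where "g' = mat n n (\<lambda>(i, j). g i j)"
    define C' where "C' = mat n n (\<lambda>(i, j). C i j)"
    have mats: "A \<in> carrier_mat n n" "C' \<in> carrier_mat n n" "g' \<in> carrier_mat n n"
      using A by (auto simp: carrier_upper_GL C'_def g'_def)
    have g': "g' \<in> carrier ?G"
      using g(1) by (auto simp: carrier_upper_GL g'_def tri_unit_def)
    have "g' * A = C' * g'"
      unfolding mult_eq_iff_intertwines[OF mats] using g(2)
      by (simp add: intertwines_def fun_of_def g'_def C'_def)
    then have gA: "g' \<otimes>\<^bsub>?G\<^esub> A = C' * g'" by (simp add: upper_GL_mult)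
    have inv: "inv\<^bsub>?G\<^esub> g' \<in> carrier_mat n n" "g' * inv\<^bsub>?G\<^esub> g' = 1\<^sub>m n"
      using inv_closed[OF g'] r_inv[OF g'] by (auto simp: carrier_upper_GL upper_GL_mult)
        (simp add: upper_GL_def GL_def units_of_def ring_mat_simps)
    have "C' = C' * (g' * inv\<^bsub>?G\<^esub> g')" using mats inv by simp
    also have "\<dots> = C' * g' * inv\<^bsub>?G\<^esub> g'" by (rule assoc_mult_mat[OF mats(2,3) inv(1), symmetric])
    also have "\<dots> = g' \<otimes>\<^bsub>?G\<^esub> A \<otimes>\<^bsub>?G\<^esub> inv\<^bsub>?G\<^esub> g'"
      unfolding gA by (simp add: upper_GL_mult)
    finally have C': "C' \<in> carrier ?G" using g' A by simp
    have "normal_form ?S (fun_of C')"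
      using C by (auto simp: normal_form_def separated_def fun_of_def C'_def)
    moreover have "(A, C') \<in> z_equivalence ?G"
      using gA by (intro z_equivalence_if_conjugate[OF A C' g']) (simp add: upper_GL_mult)
    ultimately show "\<exists>y\<in>X. y \<in> carrier ?G \<and> (A, y) \<in> z_equivalence ?G"
      using C' by (auto simp: X_def)
  qed
qed

section \<open>A one-parameter family in dimension six\<close>

text \<open>The element \<open>u\<close> is \<open>y\<close> transported back by \<open>g\<close>. It lies in the double centralizer of \<open>x\<close>, which
  gives equations for \<open>u\<close> that do not involve the unknown \<open>g\<close>.\<close>

lemma (in group) z_equivalence_imp_commutes:
  assumes "(x, y) \<in> z_equivalence G"
  obtains g u where "g \<in> carrier G" "u \<in> carrier G" "y \<otimes> g = g \<otimes> u"
    "\<And>w. w \<in> centralizer G x \<Longrightarrow> u \<otimes> w = w \<otimes> u"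
proof -
  obtain g where xy: "x \<in> carrier G" "y \<in> carrier G" and g: "g \<in> carrier G"
    and Z: "centralizer G y = g <# centralizer G x #> inv g"
    using assms by (auto simp: z_equivalence_def)
  define u where "u = inv g \<otimes> y \<otimes> g"
  have "u \<otimes> w = w \<otimes> u" if w: "w \<in> centralizer G x" for w
  proof -
    have wG: "w \<in> carrier G" using w by (simp add: centralizer_def)
    have "g \<otimes> w \<otimes> inv g \<in> centralizer G y"
      unfolding Z l_coset_def r_coset_def using w by blast
    then have comm: "y \<otimes> (g \<otimes> w \<otimes> inv g) = g \<otimes> w \<otimes> inv g \<otimes> y" by (simp add: centralizer_def)
    have "u \<otimes> w = inv g \<otimes> (y \<otimes> (g \<otimes> w \<otimes> inv g)) \<otimes> g"
      using xy g wG by (simp add: u_def m_assoc)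
    also have "\<dots> = w \<otimes> u"
      unfolding comm using xy g wG by (simp add: u_def m_assoc) (simp add: m_assoc[symmetric])
    finally show ?thesis .
  qed
  moreover have "y \<otimes> g = g \<otimes> u" using xy g by (simp add: u_def m_assoc[symmetric])
  moreover have "u \<in> carrier G" using xy g by (simp add: u_def)
  ultimately show thesis using that g by blast
qed

definition one_plus :: "nat \<Rightarrow> (nat \<Rightarrow> nat \<Rightarrow> 'k::field) \<Rightarrow> 'k mat" where
  "one_plus n f = mat n n (\<lambda>(i, j). (if i = j then 1 else 0) + f i j)"

definition in_corner :: "(nat \<Rightarrow> nat \<Rightarrow> 'k::field) \<Rightarrow> bool" where
  "in_corner f \<longleftrightarrow> (\<forall>i j. f i j \<noteq> 0 \<longrightarrow> i < j \<and> j < 6)"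

lemma in_cornerD:
  assumes "in_corner f"
  shows "j \<le> i \<Longrightarrow> f i j = 0" "6 \<le> i \<Longrightarrow> f i j = 0" "6 \<le> j \<Longrightarrow> f i j = 0"
  using assms unfolding in_corner_def by (metis leD, metis leD order_less_trans, metis leD)

lemma one_plus_carrier:
  assumes "in_corner f"
  shows "one_plus n f \<in> carrier (upper_GL TYPE('k::field) n)"
  unfolding carrier_upper_GL one_plus_def using in_cornerD(1)[OF assms] by auto

lemma one_plus_mult:
  assumes n: "6 \<le> n" and f: "in_corner f" and A: "A \<in> carrier_mat n n" and ij: "i < n" "j < n"
  shows "(one_plus n f * A) $$ (i, j) = A $$ (i, j) + (\<Sum>k<6. f i k * A $$ (k, j))"
    "(A * one_plus n f) $$ (i, j) = A $$ (i, j) + (\<Sum>k<6. A $$ (i, k) * f k j)"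
proof -
  have "(one_plus n f * A) $$ (i, j) = (\<Sum>k<n. (id_fun i k + f i k) * A $$ (k, j))"
    using A ij by (simp add: one_plus_def scalar_prod_def lessThan_atLeast0)
  also have "\<dots> = A $$ (i, j) + (\<Sum>k<n. f i k * A $$ (k, j))"
    using sum_id_fun_left[of "{..<n}" i "\<lambda>k. A $$ (k, j)"] ij
    by (simp only: distrib_right sum.distrib finite_lessThan lessThan_iff)
  also have "(\<Sum>k<n. f i k * A $$ (k, j)) = (\<Sum>k<6. f i k * A $$ (k, j))"
    using n by (intro sum.mono_neutral_right) (auto simp: in_cornerD(3)[OF f])
  finally show "(one_plus n f * A) $$ (i, j) = A $$ (i, j) + (\<Sum>k<6. f i k * A $$ (k, j))" .
  have "(A * one_plus n f) $$ (i, j) = (\<Sum>k<n. A $$ (i, k) * (id_fun k j + f k j))"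
    using A ij by (simp add: one_plus_def scalar_prod_def lessThan_atLeast0)
  also have "\<dots> = A $$ (i, j) + (\<Sum>k<n. A $$ (i, k) * f k j)"
    using sum_id_fun_right[of "{..<n}" j "\<lambda>k. A $$ (i, k)"] ij
    by (simp only: distrib_left sum.distrib finite_lessThan lessThan_iff)
  also have "(\<Sum>k<n. A $$ (i, k) * f k j) = (\<Sum>k<6. A $$ (i, k) * f k j)"
    using n by (intro sum.mono_neutral_right) (auto simp: in_cornerD(2)[OF f])
  finally show "(A * one_plus n f) $$ (i, j) = A $$ (i, j) + (\<Sum>k<6. A $$ (i, k) * f k j)" .
qed

lemma one_plus_commute:
  fixes f h :: "nat \<Rightarrow> nat \<Rightarrow> 'k::field"
  assumes n: "6 \<le> n" and f: "in_corner f" and h: "in_corner h"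
    and fh: "\<And>i j. i < 6 \<Longrightarrow> j < 6 \<Longrightarrow> (\<Sum>k<6. f i k * h k j) = (\<Sum>k<6. h i k * f k j)"
  shows "one_plus n f * one_plus n h = one_plus n h * one_plus n f"
proof (rule eq_matI)
  have mats: "one_plus n f \<in> carrier_mat n n" "one_plus n h \<in> carrier_mat n n"
    by (simp_all add: one_plus_def)
  fix i j assume "i < dim_row (one_plus n h * one_plus n f)" "j < dim_col (one_plus n h * one_plus n f)"
  then have ij: "i < n" "j < n" using mats by simp_all
  have delta: "(\<Sum>k<6. e i k * one_plus n e' $$ (k, j)) = e i j + (\<Sum>k<6. e i k * e' k j)"
    if e: "in_corner e" for e e' :: "nat \<Rightarrow> nat \<Rightarrow> 'k"
  proof -
    have "(\<Sum>k<6. e i k * one_plus n e' $$ (k, j)) = (\<Sum>k<6. (if k = j then e i j else 0) + e i k * e' k j)"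
      using n ij by (intro sum.cong) (auto simp: one_plus_def algebra_simps)
    also have "\<dots> = (if j < 6 then e i j else 0) + (\<Sum>k<6. e i k * e' k j)"
      by (simp add: sum.distrib)
    also have "(if j < 6 then e i j else 0) = e i j" using in_cornerD(3)[OF e] by simp
    finally show ?thesis .
  qed
  have "(\<Sum>k<6. f i k * h k j) = (\<Sum>k<6. h i k * f k j)"
  proof (cases "i < 6 \<and> j < 6")
    case False
    then have "6 \<le> i \<or> 6 \<le> j" by auto
    then show ?thesis using in_cornerD(2,3)[OF f] in_cornerD(2,3)[OF h] by auto
  qed (use fh in blast)
  then show "(one_plus n f * one_plus n h) $$ (i, j) = (one_plus n h * one_plus n f) $$ (i, j)"
    unfolding one_plus_mult(1)[OF n f mats(2) ij] one_plus_mult(1)[OF n h mats(1) ij]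
      delta[OF f] delta[OF h]
    using ij by (simp add: one_plus_def)
qed (simp_all add: one_plus_def)

lemma sum_lessThan_6: "(\<Sum>k<6::nat. f k) = f 0 + f 1 + f 2 + f 3 + f 4 + (f 5 :: 'k::comm_monoid_add)"
  by (simp add: eval_nat_numeral)

text \<open>Numbering basis vectors from 0, the map sends \<open>e\<^sub>5 \<mapsto> e\<^sub>4 \<mapsto> t e\<^sub>1 + e\<^sub>2\<close>,
  \<open>e\<^sub>3 \<mapsto> e\<^sub>1 + e\<^sub>2\<close> and \<open>e\<^sub>1 \<mapsto> e\<^sub>0\<close>. The two by two block with rows 1, 2 and columns 3, 4
  has a parameter which the diagonal matrices cannot absorb, and the ones at \<open>(0, 1)\<close> and \<open>(4, 5)\<close>
  prevent row and column operations from removing it.\<close>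

definition pencil :: "'k::field \<Rightarrow> nat \<Rightarrow> nat \<Rightarrow> 'k" where
  "pencil t i j = (if (i, j) = (1, 4) then t
     else if (i, j) \<in> {(0, 1), (1, 3), (2, 3), (2, 4), (4, 5)} then 1 else 0)"

definition ones_at :: "(nat \<times> nat) set \<Rightarrow> nat \<Rightarrow> nat \<Rightarrow> 'k::field" where
  "ones_at E i j = (if (i, j) \<in> E then 1 else 0)"

lemma in_corner_pencil: "in_corner (pencil t)"
  by (auto simp: in_corner_def pencil_def split: if_splits)

lemma pencil_entries:
  "pencil t i 0 = 0" "pencil t i (Suc 0) = (if i = 0 then 1 else 0)" "pencil t i 2 = 0"
  "pencil t i 3 = (if i = 1 \<or> i = 2 then 1 else 0)"
  "pencil t i 4 = (if i = 1 then t else if i = 2 then 1 else 0)" "pencil t i 5 = (if i = 4 then 1 else 0)"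
  "pencil t 0 j = (if j = 1 then 1 else 0)" "pencil t (Suc 0) j = (if j = 3 then 1 else if j = 4 then t else 0)"
  "pencil t 2 j = (if j = 3 \<or> j = 4 then 1 else 0)" "pencil t 3 j = 0"
  "pencil t 4 j = (if j = 5 then 1 else 0)" "pencil t 5 j = 0"
  by (auto simp: pencil_def)

text \<open>These three elements of the commutant, together with the matrix itself, are enough to pin down its
  double centralizer as far as needed.\<close>

lemma pencil_commutant:
  fixes E :: "(nat \<times> nat) set"
  assumes n: "6 \<le> n"
    and E: "E \<in> {{(0, 3)}, {(2, 5)}, {(0, 2), (1, 3), (1, 4), (2, 4), (3, 5)}}"
  shows "in_corner (ones_at E)" "one_plus n (pencil t) * one_plus n (ones_at E) = one_plus n (ones_at E) * one_plus n (pencil t)"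
proof -
  show "in_corner (ones_at E)"
    using E by (auto simp: in_corner_def ones_at_def split: if_splits)
  then show "one_plus n (pencil t) * one_plus n (ones_at E) = one_plus n (ones_at E) * one_plus n (pencil t)"
  proof (intro one_plus_commute n in_corner_pencil)
    fix i j :: nat assume "i < 6" "j < 6"
    then have ij: "i \<in> {0, 1, 2, 3, 4, 5}" "j \<in> {0, 1, 2, 3, 4, 5}" by auto
    show "(\<Sum>k<6. pencil t i k * ones_at E k j) = (\<Sum>k<6. ones_at E i k * pencil t k j)"
      using E unfolding insert_iff empty_iff
      by (elim disjE; (use ij in \<open>simp only: insert_iff empty_iff\<close>); elim disjE; 
          simp add: sum_lessThan_6 pencil_entries ones_at_def)
  qed
qed

text \<open>Commuting with the elements above makes the entries of \<open>u - 1\<close> at the positions of \<open>pencil t\<close>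
  equal to \<open>c\<close> times those of \<open>pencil t\<close>; in addition \<open>u\<close> vanishes at \<open>(0, 2)\<close>, \<open>(1, 2)\<close>,
  \<open>(3, 4)\<close> and \<open>(3, 5)\<close>. Then \<open>g\<close> has no entries at \<open>(1, 2)\<close> and
  \<open>(3, 4)\<close>, its diagonal entries at 1 and 2 agree, and the one at 4 is \<open>c\<close> times as
  large. The entry \<open>(1, 4)\<close> of the relation for \<open>g\<close> then compares \<open>s\<close> with \<open>t\<close>.\<close>

lemma pencil_parameter_determined:
  fixes s t :: "'k::field"
  assumes n: "6 \<le> n" and t: "t \<noteq> 0"
    and g: "g \<in> carrier (upper_GL TYPE('k) n)" and u: "u \<in> carrier (upper_GL TYPE('k) n)"
    and sg: "one_plus n (pencil s) * g = g * u"
    and comm: "\<And>w. w \<in> centralizer (upper_GL TYPE('k) n) (one_plus n (pencil t)) \<Longrightarrow> u * w = w * u"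
  shows "s = t"
proof -
  have mats: "g \<in> carrier_mat n n" "u \<in> carrier_mat n n" using g u by (simp_all add: carrier_upper_GL)
  have tri: "g $$ (i, j) = 0" "u $$ (i, j) = 0" if "j < i" "i < n" for i j
    using that g u by (auto simp: carrier_upper_GL)
  have gdiag: "g $$ (i, i) \<noteq> 0" if "i < n" for i
    using that g by (simp add: carrier_upper_GL)
  have low: "g $$ (i, j) = 0" "u $$ (i, j) = 0" if "j < i" "i < 6" for i j
    using tri[of j i] that n by auto
  have commE: "(\<Sum>k<6. u $$ (i, k) * f k j) = (\<Sum>k<6. f i k * u $$ (k, j))"
    if f: "in_corner f" and c: "one_plus n (pencil t) * one_plus n f = one_plus n f * one_plus n (pencil t)"
      and ij: "i < 6" "j < 6" for f i j
  proof -
    have "one_plus n f \<in> centralizer (upper_GL TYPE('k) n) (one_plus n (pencil t))"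
      using c one_plus_carrier[OF f] by (simp add: centralizer_def upper_GL_mult)
    then have "(u * one_plus n f) $$ (i, j) = (one_plus n f * u) $$ (i, j)" using comm by simp
    then show ?thesis using one_plus_mult[OF n f mats(2), of i j] ij n by simp
  qed
  have rel: "g $$ (i, j) + (\<Sum>k<6. pencil s i k * g $$ (k, j)) = (\<Sum>k<6. g $$ (i, k) * u $$ (k, j))"
    if ij: "i < 6" "j < 6" for i j
  proof -
    have "(g * u) $$ (i, j) = (\<Sum>k<n. g $$ (i, k) * u $$ (k, j))"
      using mats ij n by (simp add: scalar_prod_def lessThan_atLeast0)
    also have "\<dots> = (\<Sum>k<6. g $$ (i, k) * u $$ (k, j))"
      using n tri(2) ij by (intro sum.mono_neutral_right) auto
    finally show ?thesis
      using one_plus_mult(1)[OF n in_corner_pencil mats(1), of i j s] ij n sg by simp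
  qed
  note expand = sum_lessThan_6 pencil_entries low
  have udiag: "u $$ (i, i) = 1" if i: "i < 6" for i
  proof -
    have "(\<Sum>k<6. g $$ (i, k) * u $$ (k, i)) = (\<Sum>k\<in>{i}. g $$ (i, k) * u $$ (k, i))"
      using i low by (intro sum.mono_neutral_right) (auto simp: neq_iff)
    moreover have "pencil s i k * g $$ (k, i) = 0" if "k < 6" for k
      using that low(1)[of i k] in_cornerD(1)[OF in_corner_pencil, of k i s] by (cases "k \<le> i") auto
    then have "(\<Sum>k<6. pencil s i k * g $$ (k, i)) = 0" by (intro sum.neutral) simp
    ultimately show ?thesis using rel[OF i i] gdiag[of i] i n by simp
  qed
  \<comment> \<open>Entries of \<open>u\<close>, read off from the commutation relations.\<close>
  note E03 = commE[OF pencil_commutant[OF n, of "{(0, 3)}"]]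
  note E25 = commE[OF pencil_commutant[OF n, of "{(2, 5)}"]]
  note Ez = commE[OF pencil_commutant[OF n, of "{(0, 2), (1, 3), (1, 4), (2, 4), (3, 5)}"]]
  note Ex = commE[OF in_corner_pencil refl]
  have u34: "u $$ (3, 4) = 0" using E03[of 0 4] by (simp add: expand ones_at_def)
  have u35: "u $$ (3, 5) = 0" using E03[of 0 5] by (simp add: expand ones_at_def)
  have u02: "u $$ (0, 2) = 0" using E25[of 0 5] by (simp add: expand ones_at_def)
  have u12: "u $$ (1, 2) = 0" using E25[of 1 5] by (simp add: expand ones_at_def)
  define c where "c = u $$ (0, 1)"
  have u23: "u $$ (2, 3) = c" using Ez[of 0 3] u02 by (simp add: expand ones_at_def c_def)
  have u13: "u $$ (1, 3) = c" using Ex[of 0 3] u02 by (simp add: expand c_def mult.commute)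
  have u14: "u $$ (1, 4) = t * c" using Ex[of 0 4] u02 by (simp add: expand c_def mult.commute)
  have u45: "u $$ (4, 5) = c" using Ex[of 1 5] u14 u35 t by (simp add: expand mult.commute)
  have u24: "u $$ (2, 4) = c" using Ex[of 2 5] u35 u45 by (simp add: expand)
  \<comment> \<open>Entries of \<open>g\<close>, read off from \<open>(1 + pencil s) g = g u\<close>.\<close>
  have g11: "g $$ (1, 1) = g $$ (0, 0) * c" using rel[of 0 1] by (simp add: expand c_def udiag mult.commute)
  then have c: "c \<noteq> 0" using gdiag[of 1] n by auto
  have g12: "g $$ (1, 2) = 0" using rel[of 0 2] u02 u12 by (simp add: expand udiag mult.commute)
  have "g $$ (3, 3) = c * g $$ (1, 1)" using rel[of 1 3] g12 u13 by (simp add: expand udiag mult.commute)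
  moreover have "g $$ (3, 3) = c * g $$ (2, 2)" using rel[of 2 3] u23 by (simp add: expand udiag mult.commute)
  ultimately have g22: "g $$ (2, 2) = g $$ (1, 1)" using c by simp
  have g34: "g $$ (3, 4) = 0" using rel[of 3 5] u35 u45 c by (simp add: expand udiag mult.commute)
  have "s * g $$ (4, 4) = t * c * g $$ (1, 1)" 
    using rel[of 1 4] g12 u14 u34 g34 by (simp add: expand udiag mult.commute)
  moreover have "g $$ (4, 4) = c * g $$ (2, 2)"
    using rel[of 2 4] u24 u34 g34 by (simp add: expand udiag mult.commute)
  ultimately show "s = t" using c g22 gdiag[of 1] n by simp
qed

theorem infinite_z_classes_upper_GL:
  assumes n: "6 \<le> n" and inf: "infinite (UNIV :: 'k::field set)"
  shows "infinite (z_classes (upper_GL TYPE('k) n))"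
proof
  let ?G = "upper_GL TYPE('k) n"
  interpret group ?G by (rule group_upper_GL)
  assume fin: "finite (z_classes ?G)"
  define cl where "cl t = z_equivalence ?G `` {one_plus n (pencil t)}" for t :: 'k
  have x: "one_plus n (pencil t) \<in> carrier ?G" for t :: 'k
    by (rule one_plus_carrier[OF in_corner_pencil])
  have "inj_on cl (UNIV - {0})"
  proof (rule inj_onI)
    fix s t :: 'k assume "s \<in> UNIV - {0}" and t: "t \<in> UNIV - {0}" and eq: "cl s = cl t"
    have "(one_plus n (pencil t), one_plus n (pencil s)) \<in> z_equivalence ?G"
      using eq_equiv_class[OF _ equiv_z_equivalence x] eq unfolding cl_def by metis
    then obtain g u where "g \<in> carrier ?G" "u \<in> carrier ?G" "one_plus n (pencil s) * g = g * u"
      "\<And>w. w \<in> centralizer ?G (one_plus n (pencil t)) \<Longrightarrow> u * w = w * u"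
      by (rule z_equivalence_imp_commutes) (simp add: upper_GL_mult)
    then show "s = t" using pencil_parameter_determined[OF n] t by blast
  qed
  moreover have "cl ` (UNIV - {0}) \<subseteq> z_classes ?G"
    using x unfolding cl_def z_classes_def by (auto intro: quotientI)
  ultimately have "finite (UNIV - {0 :: 'k})" using fin by (meson finite_imageD finite_subset)
  then show False using inf by simp
qed

theorem theorem1p1:
  fixes n :: nat
  assumes "infinite (UNIV :: 'k::field set)"
    and "CHAR('k) \<noteq> 2"
  shows "(2 \<le> n \<and> n \<le> 5 \<longrightarrow> finite (z_classes (upper_GL TYPE('k) n))) \<and>
         (n \<ge> 6 \<longrightarrow> infinite (z_classes (upper_GL TYPE('k) n)))"
  using finite_z_classes_upper_GL[of n, where ?'k = 'k] infinite_z_classes_upper_GL[OF _ assms(1), of n]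
  by blast

end
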